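(* Let $R$ be an integral domain. The following conditions are equivalent: (i) $R$ is an integrally closed $w$-divisorial $w$-stable domain; (ii) $R$ is a $w$-stable $w$-divisorial P$v$MD; (iii) $R$ is a $w$-divisorial generalized Krull domain; (iv) $R$ is a weakly Matlis $w$-stable P$v$MD; (v) $R$ is a weakly Matlis strongly discrete P$v$MD; (vi) $R$ is a weakly Matlis generalized Krull domain.
   Context: $R$ is an integral domain with quotient field $K\neq R$. For nonzero $R$-submodules $A,B$ of $K$, $(A:B)=\{x\in K: xB\subseteq A\}$; $E(I)=(I:I)$. For a nonzero fractional ideal $I$, $I_v=(R:(R:I))$ ($I$ divisorial if $I=I_v$), $I_t=\bigcup\{J_v: J\subseteq I\text{ nonzero finitely generated}\}$ ($I$ a $t$-ideal if $I=I_t$); $t$-primes are prime $t$-ideals; $t\text{-Max}(R)$ is the set of ideals maximal among proper $t$-ideals. For a nonzero $R$-submodule $E$ of $K$, $E_w=\bigcap_{M\in t\text{-Max}(R)}ER_M$; $I$ is a $w$-ideal if $I=I_w$. $R$ is $w$-divisorial if every $w$-ideal is divisorial. $R$ is $w$-stable if every $w$-ideal $I$ satisfies $(I(E(I):I))_w=E(I)$. $R$ is weakly Matlis if each nonzero element lies in only finitely many $t$-maximal ideals and each $t$-prime is contained in a unique $t$-maximal ideal. $R$ is a P$v$MD if $R_M$ is a valuation domain for each $M\in t\text{-Max}(R)$; a P$v$MD is strongly discrete if $(P^2)_t\neq P$ for each $t$-prime $P$. A generalized Krull domain is a strongly discrete P$v$MD satisfying the ascending chain condition on radical $t$-ideals.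 *)

theory Defs
  imports Main
begin

text \<open>Convention: the integral domain R is a subring of a field of type 'a which is its
  quotient field, i.e. the quotient field K is the whole type (UNIV).\<close>

definition is_domain_with_qf :: "'a::field set \<Rightarrow> bool" where
  "is_domain_with_qf R \<longleftrightarrow> 0 \<in> R \<and> 1 \<in> R \<and>
     (\<forall>x\<in>R. \<forall>y\<in>R. x + y \<in> R \<and> x - y \<in> R \<and> x * y \<in> R) \<and>
     (\<forall>z. \<exists>a\<in>R. \<exists>b\<in>R. b \<noteq> 0 \<and> z = a / b)"

definition submod :: "'a::field set \<Rightarrow> 'a set \<Rightarrow> bool" where
  "submod R A \<longleftrightarrow> 0 \<in> A \<and> A \<noteq> {0} \<and> (\<forall>x\<in>A. \<forall>y\<in>A. x + y \<in> A) \<and>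
     (\<forall>r\<in>R. \<forall>x\<in>A. r * x \<in> A)"

definition frac_ideal :: "'a::field set \<Rightarrow> 'a set \<Rightarrow> bool" where
  "frac_ideal R I \<longleftrightarrow> submod R I \<and> (\<exists>d\<in>R. d \<noteq> 0 \<and> (\<forall>x\<in>I. d * x \<in> R))"

definition int_ideal :: "'a::field set \<Rightarrow> 'a set \<Rightarrow> bool" where
  "int_ideal R I \<longleftrightarrow> submod R I \<and> I \<subseteq> R"

definition colon :: "'a::field set \<Rightarrow> 'a set \<Rightarrow> 'a set" where
  "colon A B = {x. \<forall>b\<in>B. x * b \<in> A}"

definition Eend :: "'a::field set \<Rightarrow> 'a set" where
  "Eend I = colon I I"

definition smod_prod :: "'a::field set \<Rightarrow> 'a set \<Rightarrow> 'a set" where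
  "smod_prod A B = {\<Sum>i<n. a i * b i | (n::nat) a b. \<forall>i<n. a i \<in> A \<and> b i \<in> B}"

definition fin_gen :: "'a::field set \<Rightarrow> 'a set \<Rightarrow> bool" where
  "fin_gen R J \<longleftrightarrow> (\<exists>F. finite F \<and> J = {\<Sum>s\<in>F. c s * s | c. \<forall>s\<in>F. c s \<in> R})"

definition v_op :: "'a::field set \<Rightarrow> 'a set \<Rightarrow> 'a set" where
  "v_op R I = colon R (colon R I)"

definition t_op :: "'a::field set \<Rightarrow> 'a set \<Rightarrow> 'a set" where
  "t_op R I = \<Union> {v_op R J | J. J \<subseteq> I \<and> submod R J \<and> fin_gen R J}"

definition divisorial :: "'a::field set \<Rightarrow> 'a set \<Rightarrow> bool" where
  "divisorial R I \<longleftrightarrow> v_op R I = I"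

definition t_ideal :: "'a::field set \<Rightarrow> 'a set \<Rightarrow> bool" where
  "t_ideal R I \<longleftrightarrow> frac_ideal R I \<and> t_op R I = I"

definition prime_ideal :: "'a::field set \<Rightarrow> 'a set \<Rightarrow> bool" where
  "prime_ideal R P \<longleftrightarrow> int_ideal R P \<and> P \<noteq> R \<and>
     (\<forall>x\<in>R. \<forall>y\<in>R. x * y \<in> P \<longrightarrow> x \<in> P \<or> y \<in> P)"

definition t_prime :: "'a::field set \<Rightarrow> 'a set \<Rightarrow> bool" where
  "t_prime R P \<longleftrightarrow> prime_ideal R P \<and> t_ideal R P"

definition t_Max :: "'a::field set \<Rightarrow> 'a set set" where
  "t_Max R = {M. int_ideal R M \<and> t_ideal R M \<and> M \<noteq> R \<and>
      (\<forall>N. int_ideal R N \<and> t_ideal R N \<and> N \<noteq> R \<and> M \<subseteq> N \<longrightarrow> N = M)}"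

definition loc :: "'a::field set \<Rightarrow> 'a set \<Rightarrow> 'a set" where
  "loc R M = {a / s | a s. a \<in> R \<and> s \<in> R \<and> s \<notin> M}"

definition w_op :: "'a::field set \<Rightarrow> 'a set \<Rightarrow> 'a set" where
  "w_op R E = (\<Inter>M\<in>t_Max R. smod_prod E (loc R M))"

definition w_ideal :: "'a::field set \<Rightarrow> 'a set \<Rightarrow> bool" where
  "w_ideal R I \<longleftrightarrow> frac_ideal R I \<and> w_op R I = I"

definition w_divisorial :: "'a::field set \<Rightarrow> bool" where
  "w_divisorial R \<longleftrightarrow> (\<forall>I. w_ideal R I \<longrightarrow> divisorial R I)"

definition w_stable :: "'a::field set \<Rightarrow> bool" where
  "w_stable R \<longleftrightarrow> (\<forall>I. w_ideal R I \<longrightarrow>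
      w_op R (smod_prod I (colon (Eend I) I)) = Eend I)"

definition weakly_Matlis :: "'a::field set \<Rightarrow> bool" where
  "weakly_Matlis R \<longleftrightarrow>
     (\<forall>x\<in>R. x \<noteq> 0 \<longrightarrow> finite {M \<in> t_Max R. x \<in> M}) \<and>
     (\<forall>P. t_prime R P \<longrightarrow> (\<exists>!M. M \<in> t_Max R \<and> P \<subseteq> M))"

definition valuation_subring :: "'a::field set \<Rightarrow> bool" where
  "valuation_subring V \<longleftrightarrow> (\<forall>x. x \<noteq> 0 \<longrightarrow> x \<in> V \<or> inverse x \<in> V)"

definition PvMD :: "'a::field set \<Rightarrow> bool" where
  "PvMD R \<longleftrightarrow> (\<forall>M\<in>t_Max R. valuation_subring (loc R M))"

definition strongly_discrete_PvMD :: "'a::field set \<Rightarrow> bool" where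
  "strongly_discrete_PvMD R \<longleftrightarrow> PvMD R \<and>
     (\<forall>P. t_prime R P \<longrightarrow> t_op R (smod_prod P P) \<noteq> P)"

definition radical_ideal :: "'a::field set \<Rightarrow> 'a set \<Rightarrow> bool" where
  "radical_ideal R I \<longleftrightarrow> int_ideal R I \<and> (\<forall>x\<in>R. \<forall>n::nat. n > 0 \<and> x ^ n \<in> I \<longrightarrow> x \<in> I)"

definition acc_radical_t :: "'a::field set \<Rightarrow> bool" where
  "acc_radical_t R \<longleftrightarrow> (\<forall>f :: nat \<Rightarrow> 'a set.
      (\<forall>n. radical_ideal R (f n) \<and> t_ideal R (f n) \<and> f n \<subseteq> f (Suc n))
      \<longrightarrow> (\<exists>N. \<forall>n\<ge>N. f n = f N))"

definition generalized_Krull :: "'a::field set \<Rightarrow> bool" where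
  "generalized_Krull R \<longleftrightarrow> strongly_discrete_PvMD R \<and> acc_radical_t R"

definition integrally_closed :: "'a::field set \<Rightarrow> bool" where
  "integrally_closed R \<longleftrightarrow> (\<forall>x. (\<exists>n::nat. \<exists>c. n > 0 \<and> (\<forall>i<n. c i \<in> R) \<and>
       x ^ n + (\<Sum>i<n. c i * x ^ i) = 0) \<longrightarrow> x \<in> R)"

end

theory Submission
  imports Defs
begin

text \<open>Stability of two-generated ideals makes an integrally closed \<open>w\<close>-stable domain a P\<open>v\<close>MD, and
  in a \<open>w\<close>-stable P\<open>v\<close>MD no \<open>t\<close>-prime can be \<open>t\<close>-idempotent.

  If \<open>R\<close> is \<open>w\<close>-divisorial, every \<open>t\<close>-maximal ideal \<open>M\<close> is divisorial, which yields an element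
  lying outside \<open>R\<^sub>M\<close> but in all other localizations at \<open>t\<close>-maximal ideals. With these separating
  elements one exhibits a non-divisorial \<open>w\<close>-ideal as soon as a P\<open>v\<close>MD fails to be weakly Matlis.

  Conversely, in a weakly Matlis strongly discrete P\<open>v\<close>MD each localization \<open>J = I R\<^sub>M\<close> of a fractional
  ideal is principal over \<open>E(J)\<close>. The weakly Matlis property makes the valuation rings \<open>R\<^sub>M\<close>
  independent, so local inverses can be multiplied by some \<open>s \<notin> M\<close> to become global ones; this gives
  both \<open>w\<close>-stability and \<open>w\<close>-divisoriality. The chain condition holds because a union of
  primes of \<open>R\<^sub>M\<close> that is not idempotent is one of these primes.\<close>

section \<open>The t- and w-closures and localizations at t-maximal ideals\<close>

text \<open>Membership in R or in a w-ideal is tested at each t-maximal ideal separately, so an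
  element found at one M must be corrected at all the others at once. Finite character reduces this
  to finitely many N, and a product of elements outside M stays outside M. Prime ideals of a
  valuation ring R_M are handled through the overrings T of R_M: the maximal ideal of T is
  \<open>nonunits T\<close>, its trace on R is a t-prime when T is not K, and overrings are compared
  by division alone. In a valuation ring a sum of products of elements of a prime is a single such
  product, so non-idempotence takes the usable form that some q in the prime is not a product of two
  of its elements. This q drives both the local generators and the chain condition.\<close>

locale domain_qf =
  fixes R :: "'a::field set"
  assumes domain: "is_domain_with_qf R"
begin

lemma R_zero [simp, intro]: "0 \<in> R" and R_one [simp, intro]: "1 \<in> R"
  using domain by (auto simp: is_domain_with_qf_def)

lemma R_add [intro]: "x \<in> R \<Longrightarrow> y \<in> R \<Longrightarrow> x + y \<in> R"
  and R_diff [intro]: "x \<in> R \<Longrightarrow> y \<in> R \<Longrightarrow> x - y \<in> R"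
  and R_mult [intro]: "x \<in> R \<Longrightarrow> y \<in> R \<Longrightarrow> x * y \<in> R"
  using domain by (auto simp: is_domain_with_qf_def)

lemma R_uminus [intro]: "x \<in> R \<Longrightarrow> - x \<in> R"
  using R_diff[OF R_zero, of x] by simp

lemma R_fraction:
  obtains a b where "a \<in> R" "b \<in> R" "b \<noteq> 0" "z = a / b"
  using domain unfolding is_domain_with_qf_def by blast

text \<open>\<open>submod\<close> without the demand of a nonzero element, so that closure
  properties can be shown first and nonzeroness is settled separately by
  \<open>rmod_submod\<close>.\<close>

definition rmod :: "'a set \<Rightarrow> bool" where
  "rmod A \<longleftrightarrow> 0 \<in> A \<and> (\<forall>x\<in>A. \<forall>y\<in>A. x + y \<in> A) \<and> (\<forall>r\<in>R. \<forall>x\<in>A. r * x \<in> A)"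

lemma rmodI:
  assumes "0 \<in> A" "\<And>x y. x \<in> A \<Longrightarrow> y \<in> A \<Longrightarrow> x + y \<in> A"
    "\<And>r x. r \<in> R \<Longrightarrow> x \<in> A \<Longrightarrow> r * x \<in> A"
  shows "rmod A"
  using assms by (auto simp: rmod_def)

lemma rmod_zero: "rmod A \<Longrightarrow> 0 \<in> A"
  and rmod_add: "rmod A \<Longrightarrow> x \<in> A \<Longrightarrow> y \<in> A \<Longrightarrow> x + y \<in> A"
  and rmod_mult: "rmod A \<Longrightarrow> r \<in> R \<Longrightarrow> x \<in> A \<Longrightarrow> r * x \<in> A"
  by (auto simp: rmod_def)

lemma submod_iff: "submod R A \<longleftrightarrow> rmod A \<and> A \<noteq> {0}"
  by (auto simp: submod_def rmod_def)

lemma submod_rmod: "submod R A \<Longrightarrow> rmod A"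
  by (simp add: submod_iff)

lemma submod_nonzero:
  assumes "submod R A" obtains a where "a \<in> A" "a \<noteq> 0"
  using assms by (auto simp: submod_def)

lemma rmod_submod: "rmod A \<Longrightarrow> a \<in> A \<Longrightarrow> a \<noteq> 0 \<Longrightarrow> submod R A"
  by (auto simp: submod_iff)

lemma rmod_R: "rmod R"
  by (rule rmodI) auto

lemma rmod_sum:
  assumes "rmod A" "\<And>i. i \<in> I \<Longrightarrow> f i \<in> A"
  shows "sum f I \<in> A"
  using assms(2)
  by (induction I rule: infinite_finite_induct) (auto intro: rmod_zero rmod_add assms(1))

lemma frac_ideal_submod: "frac_ideal R I \<Longrightarrow> submod R I"
  by (simp add: frac_ideal_def)

lemma int_ideal_frac: "int_ideal R I \<Longrightarrow> frac_ideal R I"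
  unfolding int_ideal_def frac_ideal_def by (auto intro!: bexI[of _ 1])

lemma int_ideal_eq_R:
  assumes "int_ideal R I" "1 \<in> I" shows "I = R"
proof -
  have "x \<in> I" if "x \<in> R" for x
    using rmod_mult[OF submod_rmod that assms(2)] assms(1) by (simp add: int_ideal_def)
  then show ?thesis using assms(1) by (auto simp: int_ideal_def)
qed

lemma smod_prod_mem: "a \<in> A \<Longrightarrow> b \<in> B \<Longrightarrow> a * b \<in> smod_prod A B"
  unfolding smod_prod_def
  by (rule CollectI, rule exI[of _ "Suc 0"], rule exI[of _ "\<lambda>_. a"], rule exI[of _ "\<lambda>_. b"]) simp

lemma smod_prod_least:
  assumes "rmod C" "\<And>a b. a \<in> A \<Longrightarrow> b \<in> B \<Longrightarrow> a * b \<in> C"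
  shows "smod_prod A B \<subseteq> C"
  using assms(2) unfolding smod_prod_def by (auto intro!: rmod_sum[OF assms(1)])

lemma smod_prod_add:
  assumes "x \<in> smod_prod A B" "y \<in> smod_prod A B"
  shows "x + y \<in> smod_prod A B"
proof -
  obtain n :: nat and a b where x: "x = (\<Sum>i<n. a i * b i)" "\<forall>i<n. a i \<in> A \<and> b i \<in> B"
    using assms(1) unfolding smod_prod_def by blast
  obtain m :: nat and c d where y: "y = (\<Sum>i<m. c i * d i)" "\<forall>i<m. c i \<in> A \<and> d i \<in> B"
    using assms(2) unfolding smod_prod_def by blast
  let ?a = "\<lambda>i. if i < n then a i else c (i - n)"
  let ?b = "\<lambda>i. if i < n then b i else d (i - n)"
  have "(\<Sum>i<n+m. ?a i * ?b i) = (\<Sum>i<n. ?a i * ?b i) + (\<Sum>i=n..<n+m. ?a i * ?b i)"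
    using sum.atLeastLessThan_concat[of 0 n "n+m" "\<lambda>i. ?a i * ?b i"]
    by (simp add: atLeast0LessThan)
  also have "(\<Sum>i=n..<n+m. ?a i * ?b i) = (\<Sum>i<m. c i * d i)"
    using sum.shift_bounds_nat_ivl[of "\<lambda>i. ?a i * ?b i" 0 n m]
    by (simp add: atLeast0LessThan add.commute)
  finally have "x + y = (\<Sum>i<n+m. ?a i * ?b i)"
    using x(1) y(1) by simp
  moreover have "\<forall>i<n+m. ?a i \<in> A \<and> ?b i \<in> B" using x(2) y(2) by auto
  ultimately show ?thesis
    unfolding smod_prod_def
    by (rule_tac CollectI, rule_tac exI[of _ "n + m"], rule_tac exI[of _ ?a], rule_tac exI[of _ ?b]) simp
qed

lemma rmod_smod_prod:
  assumes "rmod A" shows "rmod (smod_prod A B)"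
proof (rule rmodI)
  show "0 \<in> smod_prod A B" unfolding smod_prod_def by (auto intro!: exI[of _ "0::nat"])
  show "r * x \<in> smod_prod A B" if r: "r \<in> R" and x: "x \<in> smod_prod A B" for r x
  proof -
    obtain n :: nat and a b where x: "x = (\<Sum>i<n. a i * b i)" "\<forall>i<n. a i \<in> A \<and> b i \<in> B"
      using x unfolding smod_prod_def by blast
    have "r * x = (\<Sum>i<n. (r * a i) * b i)" by (simp add: x(1) sum_distrib_left mult.assoc)
    moreover have "\<forall>i<n. r * a i \<in> A \<and> b i \<in> B" using x(2) rmod_mult[OF assms r] by blast
    ultimately show ?thesis
      unfolding smod_prod_def
      by (rule_tac CollectI, rule_tac exI[of _ n], rule_tac exI[of _ "\<lambda>i. r * a i"], rule_tac exI[of _ b]) simp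
  qed
qed (rule smod_prod_add)

section \<open>Colon modules and the v- and t-closures\<close>

lemma colonI: "(\<And>b. b \<in> B \<Longrightarrow> x * b \<in> A) \<Longrightarrow> x \<in> colon A B"
  and colonD: "x \<in> colon A B \<Longrightarrow> b \<in> B \<Longrightarrow> x * b \<in> A"
  by (auto simp: colon_def)

lemma v_op_mono: "A \<subseteq> B \<Longrightarrow> v_op R A \<subseteq> v_op R B"
  unfolding v_op_def colon_def by blast

lemma v_op_increasing: "A \<subseteq> v_op R A"
  unfolding v_op_def colon_def by (auto simp: mult.commute)

lemma v_op_memI:
  assumes "\<And>y. (\<And>f. f \<in> F \<Longrightarrow> y * f \<in> R) \<Longrightarrow> x * y \<in> R"
  shows "x \<in> v_op R F"
  using assms by (auto simp: v_op_def colon_def)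

lemma v_op_memD:
  assumes "x \<in> v_op R F" "\<And>f. f \<in> F \<Longrightarrow> y * f \<in> R"
  shows "x * y \<in> R"
  using assms by (auto simp: v_op_def colon_def)

text \<open>A set and its span are multiplied into R by the same elements, so finite generating sets
  can replace finitely generated modules.\<close>

lemma t_op_iff:
  assumes A: "submod R A"
  shows "x \<in> t_op R A \<longleftrightarrow> (\<exists>F. finite F \<and> F \<subseteq> A \<and> x \<in> v_op R F)"
proof -
  define span where "span F = {\<Sum>s\<in>F. c s * s | c. \<forall>s\<in>F. c s \<in> R}" for F :: "'a set"
  have sub: "F \<subseteq> span F" if F: "finite F" for F
  proof
    fix s assume s: "s \<in> F"
    have "s = (\<Sum>u\<in>F. (if u = s then 1 else 0) * u)"
      using s F by (simp add: if_distrib[of "\<lambda>a. a * _"] cong: if_cong)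
    then show "s \<in> span F" unfolding span_def by (rule_tac CollectI, rule_tac exI) auto
  qed
  have least: "span F \<subseteq> B" if "rmod B" "F \<subseteq> B" for F B
    unfolding span_def using that by (auto intro!: rmod_sum rmod_mult)
  have "rmod (span F)" for F
  proof (rule rmodI)
    show "0 \<in> span F" unfolding span_def by (auto intro!: exI[of _ "\<lambda>_. 0"])
    show "x + y \<in> span F" if xy: "x \<in> span F" "y \<in> span F" for x y
    proof -
      obtain c d where "x = (\<Sum>s\<in>F. c s * s)" "\<forall>s\<in>F. c s \<in> R"
        "y = (\<Sum>s\<in>F. d s * s)" "\<forall>s\<in>F. d s \<in> R"
        using xy unfolding span_def by blast
      then have "x + y = (\<Sum>s\<in>F. (c s + d s) * s)" "\<forall>s\<in>F. c s + d s \<in> R"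
        by (auto simp: sum.distrib distrib_right)
      then show ?thesis
        unfolding span_def by (rule_tac CollectI, rule_tac exI[of _ "\<lambda>s. c s + d s"]) auto
    qed
    show "r * x \<in> span F" if r: "r \<in> R" and x: "x \<in> span F" for r x
    proof -
      obtain c where "x = (\<Sum>s\<in>F. c s * s)" "\<forall>s\<in>F. c s \<in> R"
        using x unfolding span_def by blast
      then have "r * x = (\<Sum>s\<in>F. (r * c s) * s)" "\<forall>s\<in>F. r * c s \<in> R"
        using r by (auto simp: sum_distrib_left mult.assoc)
      then show ?thesis
        unfolding span_def by (rule_tac CollectI, rule_tac exI[of _ "\<lambda>s. r * c s"]) auto
    qed
  qed
  note mod = this
  have v: "v_op R (span F) = v_op R F" if F: "finite F" for F
  proof -
    have "y \<in> colon R (span F)" if "y \<in> colon R F" for y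
    proof (rule colonI)
      fix b assume "b \<in> span F"
      then obtain c where "b = (\<Sum>s\<in>F. c s * s)" "\<forall>s\<in>F. c s \<in> R"
        unfolding span_def by blast
      then have "y * b = (\<Sum>s\<in>F. c s * (y * s))" by (simp add: sum_distrib_left mult.left_commute)
      also have "\<dots> \<in> R"
        using \<open>\<forall>s\<in>F. c s \<in> R\<close> colonD[OF that] by (auto intro!: rmod_sum[OF rmod_R])
      finally show "y * b \<in> R" .
    qed
    moreover have "colon R (span F) \<subseteq> colon R F" using sub[OF F] unfolding colon_def by blast
    ultimately show ?thesis unfolding v_op_def by (metis subsetI subset_antisym)
  qed
  show ?thesis
  proof
    assume "x \<in> t_op R A"
    then obtain J F where J: "x \<in> v_op R J" "J \<subseteq> A" and F: "finite F" "J = span F"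
      unfolding t_op_def fin_gen_def span_def by blast
    then show "\<exists>F. finite F \<and> F \<subseteq> A \<and> x \<in> v_op R F"
      using v[OF F(1)] sub[OF F(1)] by auto
  next
    assume "\<exists>F. finite F \<and> F \<subseteq> A \<and> x \<in> v_op R F"
    then obtain F where F: "finite F" "F \<subseteq> A" "x \<in> v_op R F" by blast
    obtain a where a: "a \<in> A" "a \<noteq> 0" using submod_nonzero[OF A] .
    \<comment> \<open>\<open>F\<close> may be empty or \<open>{0}\<close>, and its span would then
      not be a \<open>submod\<close>.\<close>
    let ?G = "insert a F"
    have G: "finite ?G" "?G \<subseteq> A" using F a by auto
    have "x \<in> v_op R (span ?G)" using F(3) v[OF G(1)] v_op_mono[of F ?G] by auto
    moreover have "span ?G \<subseteq> A" using least G(2) A submod_rmod by blast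
    moreover have "submod R (span ?G)"
      using rmod_submod[OF mod _ a(2)] sub[OF G(1)] by auto
    moreover have "fin_gen R (span ?G)" unfolding fin_gen_def span_def using G(1) by blast
    ultimately show "x \<in> t_op R A" unfolding t_op_def by blast
  qed
qed

lemma t_op_increasing: "submod R A \<Longrightarrow> A \<subseteq> t_op R A"
proof
  fix x assume A: "submod R A" and "x \<in> A"
  then show "x \<in> t_op R A"
    unfolding t_op_iff[OF A] using v_op_increasing[of "{x}"] by (intro exI[of _ "{x}"]) auto
qed

lemma t_op_mono: "submod R A \<Longrightarrow> submod R B \<Longrightarrow> A \<subseteq> B \<Longrightarrow> t_op R A \<subseteq> t_op R B"
  by (rule subsetI) (simp add: t_op_iff, meson subset_trans)

lemma t_ideal_iff:
  assumes "frac_ideal R I"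
  shows "t_ideal R I \<longleftrightarrow> (\<forall>F. finite F \<and> F \<subseteq> I \<longrightarrow> v_op R F \<subseteq> I)"
proof -
  have "submod R I" using assms by (rule frac_ideal_submod)
  then have "t_ideal R I \<longleftrightarrow> t_op R I \<subseteq> I"
    using assms t_op_increasing[of I] unfolding t_ideal_def by auto
  also have "\<dots> \<longleftrightarrow> (\<forall>F. finite F \<and> F \<subseteq> I \<longrightarrow> v_op R F \<subseteq> I)"
    using t_op_iff[OF \<open>submod R I\<close>] by (meson subset_iff)
  finally show ?thesis .
qed

text \<open>Idempotence of the t-closure comes from its finite character: finitely many elements of
  \<open>t_op R A\<close> need only finitely many finite subsets of \<open>A\<close>, whose union is
  again finite.\<close>

lemma t_ideal_t_op:
  assumes A: "int_ideal R A"
  shows "int_ideal R (t_op R A)" "t_ideal R (t_op R A)"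
proof -
  have sA: "submod R A" and AR: "A \<subseteq> R" using A by (auto simp: int_ideal_def)
  note iff = t_op_iff[OF sA]
  have TR: "t_op R A \<subseteq> R"
  proof
    fix x assume "x \<in> t_op R A"
    then obtain F where "F \<subseteq> A" "x \<in> v_op R F" using iff by blast
    then show "x \<in> R" using v_op_memD[of x F 1] AR by auto
  qed
  have mod: "rmod (t_op R A)"
  proof (rule rmodI)
    show "0 \<in> t_op R A" using t_op_increasing[OF sA] rmod_zero[OF submod_rmod[OF sA]] by blast
    show "x + y \<in> t_op R A" if xy: "x \<in> t_op R A" "y \<in> t_op R A" for x y
    proof -
      obtain F G where FG: "finite F" "F \<subseteq> A" "x \<in> v_op R F" "finite G" "G \<subseteq> A" "y \<in> v_op R G"
        using xy iff[of x] iff[of y] by meson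
      have "x + y \<in> v_op R (F \<union> G)"
      proof (rule v_op_memI)
        fix u assume "\<And>f. f \<in> F \<union> G \<Longrightarrow> u * f \<in> R"
        then show "(x + y) * u \<in> R"
          using v_op_memD[OF FG(3), of u] v_op_memD[OF FG(6), of u] by (auto simp: distrib_right)
      qed
      then show ?thesis unfolding iff using FG by (intro exI[of _ "F \<union> G"]) auto
    qed
    show "r * x \<in> t_op R A" if r: "r \<in> R" and x: "x \<in> t_op R A" for r x
    proof -
      obtain F where F: "finite F" "F \<subseteq> A" "x \<in> v_op R F" using x iff[of x] by meson
      have "r * x \<in> v_op R F"
      proof (rule v_op_memI)
        fix u assume "\<And>f. f \<in> F \<Longrightarrow> u * f \<in> R"
        then show "r * x * u \<in> R"
          using v_op_memD[OF F(3), of u] r by (auto simp: mult.assoc)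
      qed
      then show ?thesis unfolding iff using F by (intro exI[of _ F]) auto
    qed
  qed
  obtain a where "a \<in> A" "a \<noteq> 0" using submod_nonzero[OF sA] .
  then have "submod R (t_op R A)" using rmod_submod[OF mod] t_op_increasing[OF sA] by blast
  then show int: "int_ideal R (t_op R A)" using TR by (simp add: int_ideal_def)
  show "t_ideal R (t_op R A)"
    unfolding t_ideal_iff[OF int_ideal_frac[OF int]]
  proof (intro allI impI subsetI)
    fix F x assume F: "finite F \<and> F \<subseteq> t_op R A" and x: "x \<in> v_op R F"
    then have "\<forall>f\<in>F. \<exists>G. finite G \<and> G \<subseteq> A \<and> f \<in> v_op R G"
      using iff by (meson subsetD)
    then obtain G where G: "\<And>f. f \<in> F \<Longrightarrow> finite (G f) \<and> G f \<subseteq> A \<and> f \<in> v_op R (G f)"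
      by metis
    have "x \<in> v_op R (\<Union>f\<in>F. G f)"
    proof (rule v_op_memI)
      fix y assume y: "\<And>g. g \<in> (\<Union>f\<in>F. G f) \<Longrightarrow> y * g \<in> R"
      have "y * f \<in> R" if "f \<in> F" for f
        using v_op_memD[of f "G f" y] G[OF that] y that by (auto simp: mult.commute)
      then show "x * y \<in> R" using v_op_memD[OF x] by blast
    qed
    then show "x \<in> t_op R A" unfolding iff using F G by (intro exI[of _ "\<Union>f\<in>F. G f"]) auto
  qed
qed

text \<open>Zorn applies because being a t-ideal is tested on finite subsets, and a finite subset of
  the union of a chain lies in one member.\<close>

lemma t_Max_exists:
  assumes A: "int_ideal R A" "t_ideal R A" "A \<noteq> R"
  obtains M where "M \<in> t_Max R" "A \<subseteq> M"
proof -
  define Z where "Z = {N. int_ideal R N \<and> t_ideal R N \<and> N \<noteq> R \<and> A \<subseteq> N}"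
  have "\<exists>M\<in>Z. \<forall>X\<in>Z. M \<subseteq> X \<longrightarrow> X = M"
  proof (rule subset_Zorn_nonempty)
    show "Z \<noteq> {}" using A unfolding Z_def by blast
    fix \<C> assume ne: "\<C> \<noteq> {}" and ch: "subset.chain Z \<C>"
    have Cprop: "int_ideal R N" "t_ideal R N" "N \<noteq> R" "A \<subseteq> N" if "N \<in> \<C>" for N
      using ch that unfolding subset.chain_def Z_def by blast+
    have fin: "\<exists>N\<in>\<C>. F \<subseteq> N" if "finite F" "F \<subseteq> \<Union>\<C>" for F
      using finite_subset_Union_chain[OF that ne ch] by blast
    have mod: "rmod (\<Union>\<C>)"
    proof (rule rmodI)
      have sm: "rmod N" if "N \<in> \<C>" for N
        using Cprop(1)[OF that] submod_rmod by (simp add: int_ideal_def)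
      show "0 \<in> \<Union>\<C>" using ne sm rmod_zero by blast
      show "x + y \<in> \<Union>\<C>" if "x \<in> \<Union>\<C>" "y \<in> \<Union>\<C>" for x y
        using fin[of "{x, y}"] that rmod_add[OF sm, of _ x y] by auto
      show "r * x \<in> \<Union>\<C>" if "r \<in> R" "x \<in> \<Union>\<C>" for r x
        using that rmod_mult[OF sm, of _ r x] by auto
    qed
    obtain N where N: "N \<in> \<C>" using ne by blast
    obtain a where "a \<in> N" "a \<noteq> 0"
      using Cprop(1)[OF N] submod_nonzero unfolding int_ideal_def by blast
    then have "submod R (\<Union>\<C>)" using rmod_submod[OF mod] N by blast
    moreover have "\<Union>\<C> \<subseteq> R" using Cprop(1) unfolding int_ideal_def by blast
    ultimately have int: "int_ideal R (\<Union>\<C>)" by (simp add: int_ideal_def)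
    have "t_ideal R (\<Union>\<C>)"
      unfolding t_ideal_iff[OF int_ideal_frac[OF int]]
    proof (intro allI impI)
      fix F assume F: "finite F \<and> F \<subseteq> \<Union>\<C>"
      then obtain N where N: "N \<in> \<C>" "F \<subseteq> N" using fin by blast
      then show "v_op R F \<subseteq> \<Union>\<C>"
        using F t_ideal_iff[OF int_ideal_frac[OF Cprop(1)[OF N(1)]]] Cprop(2)[OF N(1)] by blast
    qed
    moreover have "1 \<notin> \<Union>\<C>" using Cprop(1,3) int_ideal_eq_R by blast
    moreover have "A \<subseteq> \<Union>\<C>" using N Cprop(4) by blast
    ultimately show "\<Union>\<C> \<in> Z" using int unfolding Z_def by auto
  qed
  then obtain M where "M \<in> Z" "\<forall>X\<in>Z. M \<subseteq> X \<longrightarrow> X = M" by blast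
  then have "M \<in> t_Max R" "A \<subseteq> M" unfolding Z_def t_Max_def by auto
  then show ?thesis by (rule that)
qed

text \<open>The finite witness, rather than \<open>t_op R A = R\<close>, is what later proofs
  multiply by a fixed element.\<close>

lemma not_subset_t_Max:
  assumes A: "int_ideal R A" and not: "\<And>M. M \<in> t_Max R \<Longrightarrow> \<not> A \<subseteq> M"
  obtains F where "finite F" "F \<subseteq> A" "1 \<in> v_op R F"
proof -
  have sA: "submod R A" using A by (simp add: int_ideal_def)
  have "t_op R A = R"
  proof (rule ccontr)
    assume "t_op R A \<noteq> R"
    then obtain M where "M \<in> t_Max R" "t_op R A \<subseteq> M"
      using t_Max_exists t_ideal_t_op[OF A] by blast
    then show False using not t_op_increasing[OF sA] by blast
  qed
  then have "1 \<in> t_op R A" by simp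
  then show ?thesis using that t_op_iff[OF sA] by blast
qed

section \<open>Primality of t-maximal ideals and the rings R_M\<close>

context
  fixes M assumes M: "M \<in> t_Max R"
begin

lemma t_Max_int: "int_ideal R M" and t_Max_t_ideal: "t_ideal R M"
  using M by (auto simp: t_Max_def)

lemma t_Max_subset: "M \<subseteq> R" and t_Max_submod: "submod R M"
  using t_Max_int by (auto simp: int_ideal_def)

lemma t_Max_rmod: "rmod M"
  using t_Max_submod submod_rmod by blast

lemma t_Max_one: "1 \<notin> M"
  using M int_ideal_eq_R by (auto simp: t_Max_def)

lemma t_Max_zero: "0 \<in> M"
  using rmod_zero t_Max_rmod by blast

lemma t_Max_v_op: "finite F \<Longrightarrow> F \<subseteq> M \<Longrightarrow> v_op R F \<subseteq> M"
  using t_ideal_iff[OF int_ideal_frac[OF t_Max_int]] t_Max_t_ideal by blast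

text \<open>The ideal A = M + Rx lies in no t-maximal ideal, so 1 is in the v-closure of a finite F
  \<subseteq> A. As yF \<subseteq> M, the v-closure of yF stays in M, yet it contains y.\<close>

lemma t_Max_mult_notin:
  assumes xy: "x \<in> R" "x \<notin> M" "y \<in> R" "y \<notin> M"
  shows "x * y \<notin> M"
proof
  assume xyM: "x * y \<in> M"
  define A where "A = {m + r * x | m r. m \<in> M \<and> r \<in> R}"
  have mA: "m \<in> A" if "m \<in> M" for m
    unfolding A_def using that by (rule_tac CollectI, rule_tac exI[of _ m], rule_tac exI[of _ 0]) auto
  have xA: "x \<in> A"
    unfolding A_def using t_Max_zero by (rule_tac CollectI, rule_tac exI[of _ 0], rule_tac exI[of _ 1]) auto
  have "rmod A"
  proof (rule rmodI)
    show "0 \<in> A" using mA t_Max_zero by blast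
    show "u + v \<in> A" if uv: "u \<in> A" "v \<in> A" for u v
    proof -
      obtain m r n s where "u = m + r * x" "m \<in> M" "r \<in> R" "v = n + s * x" "n \<in> M" "s \<in> R"
        using uv unfolding A_def by blast
      then have "u + v = (m + n) + (r + s) * x" "m + n \<in> M" "r + s \<in> R"
        using rmod_add[OF t_Max_rmod] by (auto simp: algebra_simps)
      then show ?thesis unfolding A_def by blast
    qed
    show "r * v \<in> A" if r: "r \<in> R" and v: "v \<in> A" for r v
    proof -
      obtain n s where "v = n + s * x" "n \<in> M" "s \<in> R" using v unfolding A_def by blast
      then have "r * v = r * n + (r * s) * x" "r * n \<in> M" "r * s \<in> R"
        using r by (auto simp: distrib_left mult.assoc intro: rmod_mult[OF t_Max_rmod])
      then show ?thesis unfolding A_def by blast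
    qed
  qed
  moreover have "A \<subseteq> R" using t_Max_subset xy unfolding A_def by auto
  ultimately have A: "int_ideal R A"
    using rmod_submod[OF _ xA] xy t_Max_zero by (auto simp: int_ideal_def)
  have "\<not> A \<subseteq> N" if N: "N \<in> t_Max R" for N
  proof
    assume "A \<subseteq> N"
    then have "M \<subseteq> N" "x \<in> N" using mA xA by auto
    moreover have "N = M" using M N \<open>M \<subseteq> N\<close> unfolding t_Max_def by blast
    ultimately show False using xy by blast
  qed
  then obtain F where F: "finite F" "F \<subseteq> A" "1 \<in> v_op R F"
    using not_subset_t_Max[OF A] by blast
  have "(\<lambda>f. y * f) ` F \<subseteq> M"
  proof
    fix z assume "z \<in> (\<lambda>f. y * f) ` F"
    then obtain m r where z: "z = y * (m + r * x)" "m \<in> M" "r \<in> R" using F(2) unfolding A_def by blast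
    have "z = y * m + r * (x * y)" using z by (simp add: algebra_simps)
    then show "z \<in> M" using z xy xyM rmod_add[OF t_Max_rmod] rmod_mult[OF t_Max_rmod] by auto
  qed
  moreover have "y \<in> v_op R ((\<lambda>f. y * f) ` F)"
  proof (rule v_op_memI)
    fix u assume u: "\<And>f. f \<in> (\<lambda>f. y * f) ` F \<Longrightarrow> u * f \<in> R"
    have "y * u * f \<in> R" if "f \<in> F" for f using u[OF imageI[OF that]] by (simp add: mult_ac)
    then show "y * u \<in> R" using v_op_memD[OF F(3), of "y * u"] by simp
  qed
  ultimately show False using t_Max_v_op[of "(\<lambda>f. y * f) ` F"] F(1) xy by blast
qed

lemma t_Max_prod_notin:
  assumes "finite A" "\<And>a. a \<in> A \<Longrightarrow> f a \<in> R \<and> f a \<notin> M"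
  shows "prod f A \<in> R \<and> prod f A \<notin> M"
  using assms
proof (induction A rule: finite_induct)
  case empty
  then show ?case by (simp add: t_Max_one)
next
  case (insert a A)
  then show ?case using t_Max_mult_notin[of "f a" "prod f A"] by auto
qed

lemma loc_iff: "x \<in> loc R M \<longleftrightarrow> (\<exists>s. s \<in> R \<and> s \<notin> M \<and> s * x \<in> R)"
proof
  assume "x \<in> loc R M"
  then obtain a s where "x = a / s" "a \<in> R" "s \<in> R" "s \<notin> M" unfolding loc_def by blast
  moreover then have "s \<noteq> 0" using t_Max_zero by blast
  ultimately show "\<exists>s. s \<in> R \<and> s \<notin> M \<and> s * x \<in> R" by (intro exI[of _ s]) auto
next
  assume "\<exists>s. s \<in> R \<and> s \<notin> M \<and> s * x \<in> R"
  then obtain s where s: "s \<in> R" "s \<notin> M" "s * x \<in> R" by blast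
  then have "x = (s * x) / s" using t_Max_zero by auto
  then show "x \<in> loc R M" unfolding loc_def using s by blast
qed

lemma R_subset_loc: "R \<subseteq> loc R M"
proof
  fix x assume "x \<in> R"
  then show "x \<in> loc R M" unfolding loc_iff using t_Max_one by (intro exI[of _ 1]) auto
qed

lemma loc_inverse: "s \<in> R \<Longrightarrow> s \<notin> M \<Longrightarrow> 1 / s \<in> loc R M"
  unfolding loc_def by blast

lemma loc_mult: "x \<in> loc R M \<Longrightarrow> y \<in> loc R M \<Longrightarrow> x * y \<in> loc R M"
proof -
  assume "x \<in> loc R M" "y \<in> loc R M"
  then obtain s t where "s \<in> R" "s \<notin> M" "s * x \<in> R" "t \<in> R" "t \<notin> M" "t * y \<in> R"
    using loc_iff by blast
  moreover have "(s * t) * (x * y) = (s * x) * (t * y)" by (simp add: mult_ac)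
  ultimately show ?thesis using loc_iff t_Max_mult_notin R_mult by metis
qed

lemma loc_add: "x \<in> loc R M \<Longrightarrow> y \<in> loc R M \<Longrightarrow> x + y \<in> loc R M"
proof -
  assume "x \<in> loc R M" "y \<in> loc R M"
  then obtain s t where "s \<in> R" "s \<notin> M" "s * x \<in> R" "t \<in> R" "t \<notin> M" "t * y \<in> R"
    using loc_iff by blast
  moreover have "(s * t) * (x + y) = t * (s * x) + s * (t * y)" by (simp add: algebra_simps)
  ultimately show ?thesis using loc_iff t_Max_mult_notin R_mult R_add by metis
qed

lemma loc_rmod: "rmod (loc R M)"
  by (rule rmodI) (use R_subset_loc in \<open>blast intro: loc_add loc_mult\<close>)+

lemma loc_not_UNIV: "loc R M \<noteq> UNIV"
proof -
  obtain m where m: "m \<in> M" "m \<noteq> 0" using submod_nonzero[OF t_Max_submod] .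
  have "1 / m \<notin> loc R M"
  proof
    assume "1 / m \<in> loc R M"
    then obtain s where s: "s \<in> R" "s \<notin> M" "s * (1 / m) \<in> R" using loc_iff by blast
    have "(s * (1 / m)) * m \<in> M" using rmod_mult[OF t_Max_rmod s(3) m(1)] .
    then show False using s m by simp
  qed
  then show ?thesis by blast
qed

end

section \<open>Localizations of modules and the w-closure\<close>

lemma t_Max_incomparable:
  assumes "M \<in> t_Max R" "N \<in> t_Max R" "M \<noteq> N"
  obtains s where "s \<in> M" "s \<notin> N" "s \<in> R"
  using assms t_Max_subset[OF assms(1)] unfolding t_Max_def by blast

text \<open>\<open>lext E M\<close> is the localization \<open>E R\<^sub>M\<close>.\<close>

definition lext :: "'a set \<Rightarrow> 'a set \<Rightarrow> 'a set" where
  "lext E M = {z. \<exists>s. s \<in> R \<and> s \<notin> M \<and> s * z \<in> E}"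

lemma lextI: "s \<in> R \<Longrightarrow> s \<notin> M \<Longrightarrow> s * z \<in> E \<Longrightarrow> z \<in> lext E M"
  by (auto simp: lext_def)

lemma lext_mono: "E \<subseteq> F \<Longrightarrow> lext E M \<subseteq> lext F M"
  by (auto simp: lext_def)

lemma lext_R: "M \<in> t_Max R \<Longrightarrow> lext R M = loc R M"
  using loc_iff by (auto simp: lext_def)

lemma lext_subset: "M \<in> t_Max R \<Longrightarrow> E \<subseteq> lext E M"
  using lextI[OF R_one t_Max_one] by (metis mult_1 subsetI)

lemma lext_add:
  assumes "M \<in> t_Max R" "rmod E" "x \<in> lext E M" "y \<in> lext E M"
  shows "x + y \<in> lext E M"
proof -
  obtain s t where st: "s \<in> R" "s \<notin> M" "s * x \<in> E" "t \<in> R" "t \<notin> M" "t * y \<in> E"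
    using assms by (auto simp: lext_def)
  have "(s * t) * (x + y) = t * (s * x) + s * (t * y)" by (simp add: algebra_simps)
  then have "(s * t) * (x + y) \<in> E" using st assms(2) by (auto intro!: rmod_add rmod_mult)
  then show ?thesis using st t_Max_mult_notin[OF assms(1)] by (auto intro!: lextI[of "s * t"])
qed

lemma lext_mult:
  assumes "M \<in> t_Max R" "rmod E" "x \<in> lext E M" "y \<in> loc R M"
  shows "x * y \<in> lext E M"
proof -
  obtain s t where st: "s \<in> R" "s \<notin> M" "s * x \<in> E" "t \<in> R" "t \<notin> M" "t * y \<in> R"
    using assms loc_iff[OF assms(1)] by (auto simp: lext_def)
  have "(s * t) * (x * y) = (t * y) * (s * x)" by (simp add: algebra_simps)
  then have "(s * t) * (x * y) \<in> E" using rmod_mult[OF assms(2) st(6,3)] by (simp only:)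
  then show ?thesis using st t_Max_mult_notin[OF assms(1)] by (auto intro!: lextI[of "s * t"])
qed

lemma lext_rmod: "M \<in> t_Max R \<Longrightarrow> rmod E \<Longrightarrow> rmod (lext E M)"
proof (rule rmodI)
  assume M: "M \<in> t_Max R" and E: "rmod E"
  show "0 \<in> lext E M" using rmod_zero[OF E] lext_subset[OF M] by blast
  show "x + y \<in> lext E M" if "x \<in> lext E M" "y \<in> lext E M" for x y
    using lext_add[OF M E that] .
  show "r * x \<in> lext E M" if "r \<in> R" "x \<in> lext E M" for r x
    using lext_mult[OF M E that(2)] R_subset_loc[OF M] that(1) by (auto simp: mult.commute)
qed

text \<open>A sum of fractions has a common denominator outside M, so one quotient represents each
  element of E R_M.\<close>

lemma smod_prod_loc:
  assumes M: "M \<in> t_Max R" and E: "rmod E"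
  shows "smod_prod E (loc R M) = lext E M"
proof
  show "smod_prod E (loc R M) \<subseteq> lext E M"
    using lext_subset[OF M] lext_mult[OF M E]
    by (intro smod_prod_least lext_rmod M E) blast
  show "lext E M \<subseteq> smod_prod E (loc R M)"
  proof
    fix z assume "z \<in> lext E M"
    then obtain s where s: "s \<in> R" "s \<notin> M" "s * z \<in> E" by (auto simp: lext_def)
    have "(s * z) * (1 / s) \<in> smod_prod E (loc R M)"
      by (rule smod_prod_mem[OF s(3) loc_inverse[OF M s(1,2)]])
    moreover have "s \<noteq> 0" using s t_Max_zero[OF M] by auto
    ultimately show "z \<in> smod_prod E (loc R M)" by simp
  qed
qed

lemma w_op_iff:
  assumes "rmod E"
  shows "x \<in> w_op R E \<longleftrightarrow> (\<forall>M\<in>t_Max R. x \<in> lext E M)"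
  unfolding w_op_def using smod_prod_loc[OF _ assms] by auto

lemma w_op_increasing: "rmod E \<Longrightarrow> E \<subseteq> w_op R E"
  using w_op_iff lext_subset by blast

lemma w_op_lext:
  assumes "rmod E" "M \<in> t_Max R" shows "lext (w_op R E) M \<subseteq> lext E M"
proof
  fix z assume "z \<in> lext (w_op R E) M"
  then obtain s where s: "s \<in> R" "s \<notin> M" "s * z \<in> w_op R E" by (auto simp: lext_def)
  then obtain t where t: "t \<in> R" "t \<notin> M" "t * (s * z) \<in> E"
    using w_op_iff[OF assms(1)] assms(2) unfolding lext_def by blast
  then show "z \<in> lext E M"
    using s t_Max_mult_notin[OF assms(2)] by (intro lextI[of "t * s"]) (auto simp: mult_ac)
qed

lemma w_op_rmod: "rmod E \<Longrightarrow> rmod (w_op R E)"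
  by (rule rmodI) (auto simp: w_op_iff intro: rmod_zero[OF lext_rmod] rmod_add[OF lext_rmod] rmod_mult[OF lext_rmod])

lemma w_idealI:
  assumes "frac_ideal R I" "\<And>z. (\<And>M. M \<in> t_Max R \<Longrightarrow> z \<in> lext I M) \<Longrightarrow> z \<in> I"
  shows "w_ideal R I"
proof -
  have "rmod I" using assms(1) frac_ideal_submod submod_rmod by blast
  then show ?thesis
    unfolding w_ideal_def using assms w_op_increasing[of I] w_op_iff[of I] by blast
qed

lemma w_ideal_rmod: "w_ideal R I \<Longrightarrow> rmod I"
  using frac_ideal_submod submod_rmod unfolding w_ideal_def by blast

lemma w_idealD:
  assumes "w_ideal R I" "\<And>M. M \<in> t_Max R \<Longrightarrow> z \<in> lext I M"
  shows "z \<in> I"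
  using assms w_op_iff[OF w_ideal_rmod[OF assms(1)]] unfolding w_ideal_def by blast

text \<open>This is the ideal of denominators of \<open>x\<close> over \<open>I\<close>:
  \<open>x\<close> is in \<open>lext I M\<close> exactly when it is not contained in
  \<open>M\<close>.\<close>

lemma transporter_int_ideal:
  assumes "rmod I" "a \<in> R" "a \<noteq> 0" "a * x \<in> I"
  shows "int_ideal R {r \<in> R. r * x \<in> I}"
proof -
  have "rmod {r \<in> R. r * x \<in> I}"
    using assms(1) by (intro rmodI) (auto simp: distrib_right mult.assoc intro: rmod_zero rmod_add rmod_mult)
  then show ?thesis using rmod_submod[of _ a] assms unfolding int_ideal_def by auto
qed

text \<open>If x is locally in I, its ideal of denominators lies in no t-maximal ideal, so 1 is in
  the v-closure of a finite set F of denominators. Multiplying by x puts x in the v-closure of Fx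
  \<subseteq> I.\<close>

lemma w_op_subset_t_op:
  assumes I: "submod R I"
  shows "w_op R I \<subseteq> t_op R I"
proof
  fix x assume x: "x \<in> w_op R I"
  have mod: "rmod I" using I submod_rmod by blast
  obtain c where c: "c \<in> I" "c \<noteq> 0" using submod_nonzero[OF I] .
  show "x \<in> t_op R I"
  proof (cases "x = 0")
    case True then show ?thesis using t_op_increasing[OF I] rmod_zero[OF mod] by blast
  next
    case False
    \<comment> \<open>Writing c/x as a fraction a/b produces a nonzero denominator a of x.\<close>
    obtain a b where ab: "a \<in> R" "b \<in> R" "b \<noteq> 0" "c / x = a / b" using R_fraction .
    have "a * x = b * c" using ab False by (simp add: field_simps)
    then have "a * x \<in> I" "a \<noteq> 0" using ab c rmod_mult[OF mod] by auto
    then have int: "int_ideal R {r \<in> R. r * x \<in> I}" using transporter_int_ideal[OF mod] ab by blast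
    have "\<not> {r \<in> R. r * x \<in> I} \<subseteq> M" if "M \<in> t_Max R" for M
      using x w_op_iff[OF mod] that unfolding lext_def by blast
    then obtain F where F: "finite F" "F \<subseteq> {r \<in> R. r * x \<in> I}" "1 \<in> v_op R F"
      using not_subset_t_Max[OF int] by blast
    have "x \<in> v_op R ((\<lambda>f. f * x) ` F)"
    proof (rule v_op_memI)
      fix y assume y: "\<And>f. f \<in> (\<lambda>f. f * x) ` F \<Longrightarrow> y * f \<in> R"
      have "x * y * f \<in> R" if "f \<in> F" for f using y[OF imageI[OF that]] by (simp add: mult_ac)
      then show "x * y \<in> R" using v_op_memD[OF F(3), of "x * y"] by simp
    qed
    then show ?thesis unfolding t_op_iff[OF I] using F by (intro exI[of _ "(\<lambda>f. f * x) ` F"]) auto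
  qed
qed

lemma t_ideal_w_ideal: "t_ideal R I \<Longrightarrow> w_ideal R I"
  using w_op_subset_t_op[of I] w_op_increasing[of I] frac_ideal_submod[of I] submod_rmod[of I]
  unfolding t_ideal_def w_ideal_def by blast

lemma w_ideal_R: "w_ideal R R"
proof (rule t_ideal_w_ideal)
  have int: "int_ideal R R" using rmod_submod[OF rmod_R R_one] by (simp add: int_ideal_def)
  show "t_ideal R R"
    unfolding t_ideal_iff[OF int_ideal_frac[OF int]]
    using v_op_memD[where y = 1] by (auto simp: subset_iff)
qed

lemma in_R_if_loc:
  assumes "\<And>M. M \<in> t_Max R \<Longrightarrow> x \<in> loc R M"
  shows "x \<in> R"
  using w_idealD[OF w_ideal_R] assms lext_R by blast

section \<open>Valuation overrings and PvMDs\<close>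

definition overring :: "'a set \<Rightarrow> bool" where
  "overring T \<longleftrightarrow> R \<subseteq> T \<and> (\<forall>x\<in>T. \<forall>y\<in>T. x + y \<in> T \<and> x * y \<in> T)"

lemma overring_R: "overring T \<Longrightarrow> R \<subseteq> T"
  and overring_add: "overring T \<Longrightarrow> x \<in> T \<Longrightarrow> y \<in> T \<Longrightarrow> x + y \<in> T"
  and overring_mult: "overring T \<Longrightarrow> x \<in> T \<Longrightarrow> y \<in> T \<Longrightarrow> x * y \<in> T"
  by (auto simp: overring_def)

lemma overring_zero: "overring T \<Longrightarrow> 0 \<in> T" and overring_one: "overring T \<Longrightarrow> 1 \<in> T"
  using overring_R by auto

lemma overring_rmod: "overring T \<Longrightarrow> rmod T"
  by (rule rmodI) (auto simp: overring_def)

lemma overring_power: "overring T \<Longrightarrow> x \<in> T \<Longrightarrow> x ^ n \<in> T"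
  by (induction n) (auto intro: overring_one overring_mult)

lemma overring_loc: "M \<in> t_Max R \<Longrightarrow> overring (loc R M)"
  unfolding overring_def by (simp add: R_subset_loc loc_add loc_mult)

definition valuation_overring :: "'a set \<Rightarrow> bool" where
  "valuation_overring V \<longleftrightarrow> overring V \<and> valuation_subring V"

lemma PvMD_loc: "PvMD R \<Longrightarrow> M \<in> t_Max R \<Longrightarrow> valuation_overring (loc R M)"
  by (simp add: PvMD_def valuation_overring_def overring_loc)

lemma valuation_overring_cases:
  assumes "valuation_overring V" "x \<noteq> 0" "y \<noteq> 0"
  obtains "x / y \<in> V" | "y / x \<in> V"
proof -
  have "x / y \<noteq> 0" using assms by simp
  then have "x / y \<in> V \<or> inverse (x / y) \<in> V"
    using assms(1) unfolding valuation_overring_def valuation_subring_def by blast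
  then show ?thesis using that by auto
qed

text \<open>Membership in \<open>T\<close> is not part of the condition: when \<open>T\<close>
  contains a valuation ring, an element outside \<open>T\<close> has its inverse in
  \<open>T\<close>, so the set is then exactly the maximal ideal of \<open>T\<close>.\<close>

definition nonunits :: "'a set \<Rightarrow> 'a set" where
  "nonunits T = {z. z = 0 \<or> 1 / z \<notin> T}"

lemma nonunits_mult:
  assumes T: "overring T" and z: "z \<in> nonunits T" and u: "u \<in> T"
  shows "z * u \<in> nonunits T"
proof (rule ccontr)
  assume "z * u \<notin> nonunits T"
  then have "z * u \<noteq> 0" "1 / (z * u) \<in> T" by (auto simp: nonunits_def)
  then have "u * (1 / (z * u)) \<in> T" using overring_mult[OF T u] by blast
  moreover have "u * (1 / (z * u)) = 1 / z" using \<open>z * u \<noteq> 0\<close> by simp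
  ultimately show False using z \<open>z * u \<noteq> 0\<close> by (auto simp: nonunits_def)
qed

text \<open>The maximal ideal of a larger valuation ring lies inside every smaller one. Hence
  multiplication by a nonunit of \<open>T\<close> carries \<open>T\<close> into
  \<open>V\<close>.\<close>

lemma nonunits_subset:
  assumes V: "valuation_overring V" and VT: "V \<subseteq> T"
  shows "nonunits T \<subseteq> V"
proof
  fix z assume z: "z \<in> nonunits T"
  show "z \<in> V"
  proof (cases "z = 0")
    case True
    then show ?thesis using V overring_zero by (simp add: valuation_overring_def)
  next
    case False
    then have "1 / z \<notin> V" using z VT by (auto simp: nonunits_def)
    then show ?thesis using valuation_overring_cases[OF V False, of 1] by auto
  qed
qed

lemma nonunits_add:
  assumes V: "valuation_overring V" and VT: "V \<subseteq> T" and T: "overring T"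
    and x: "x \<in> nonunits T" and y: "y \<in> nonunits T"
  shows "x + y \<in> nonunits T"
proof (cases "x = 0 \<or> y = 0")
  case True then show ?thesis using x y by auto
next
  case False
  then have nz: "x \<noteq> 0" "y \<noteq> 0" by auto
  have V1: "1 \<in> V" "overring V" using V overring_one by (auto simp: valuation_overring_def)
  show ?thesis
  proof (rule valuation_overring_cases[OF V nz])
    assume "x / y \<in> V"
    then have "1 + x / y \<in> T" using VT overring_add[OF V1(2) V1(1)] by blast
    then have "y * (1 + x / y) \<in> nonunits T" using nonunits_mult[OF T y] by blast
    moreover have "y * (1 + x / y) = x + y" using nz by (simp add: field_simps)
    ultimately show ?thesis by simp
  next
    assume "y / x \<in> V"
    then have "1 + y / x \<in> T" using VT overring_add[OF V1(2) V1(1)] by blast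
    then have "x * (1 + y / x) \<in> nonunits T" using nonunits_mult[OF T x] by blast
    moreover have "x * (1 + y / x) = x + y" using nz by (simp add: field_simps)
    ultimately show ?thesis by simp
  qed
qed

text \<open>For x in S outside T and y in T outside S, one of x/y and y/x is in V, which puts x in T
  or y in S.\<close>

lemma overrings_linear:
  assumes V: "valuation_overring V" and S: "overring S" "V \<subseteq> S" and T: "overring T" "V \<subseteq> T"
  shows "S \<subseteq> T \<or> T \<subseteq> S"
proof (rule ccontr)
  assume "\<not> (S \<subseteq> T \<or> T \<subseteq> S)"
  then obtain x y where xy: "x \<in> S" "x \<notin> T" "y \<in> T" "y \<notin> S" by blast
  then have nz: "x \<noteq> 0" "y \<noteq> 0" using S(1) T(1) overring_zero by auto
  show False
  proof (rule valuation_overring_cases[OF V nz])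
    assume "x / y \<in> V"
    then have "y * (x / y) \<in> T" using T xy overring_mult by blast
    then show False using xy nz by simp
  next
    assume "y / x \<in> V"
    then have "x * (y / x) \<in> S" using S xy overring_mult by blast
    then show False using xy nz by simp
  qed
qed

text \<open>Over a valuation ring, one generator of a finitely generated module generates it
  alone.\<close>

lemma valuation_overring_dominating:
  assumes V: "valuation_overring V" and F: "finite F" "a \<in> F" "a \<noteq> 0"
  obtains g where "g \<in> F" "g \<noteq> 0" "\<And>f. f \<in> F \<Longrightarrow> f / g \<in> V"
proof -
  have ov: "overring V" using V by (simp add: valuation_overring_def)
  \<comment> \<open>The base case needs a nonzero candidate, hence the induction over
    \<open>insert a G\<close>.\<close>
  have "\<exists>g\<in>insert a G. g \<noteq> 0 \<and> (\<forall>f\<in>insert a G. f / g \<in> V)" if "finite G" for G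
    using that
  proof (induction G rule: finite_induct)
    case empty
    then show ?case using F overring_one[OF ov] by auto
  next
    case (insert b G)
    then obtain g where g: "g \<in> insert a G" "g \<noteq> 0" "\<And>f. f \<in> insert a G \<Longrightarrow> f / g \<in> V" by blast
    show ?case
    proof (cases "b / g \<in> V")
      case True
      then show ?thesis using g by (intro bexI[of _ g]) auto
    next
      case False
      then have b: "b \<noteq> 0" using overring_zero[OF ov] by auto
      then have gb: "g / b \<in> V" using valuation_overring_cases[OF V b g(2)] False by blast
      have "f / b \<in> V" if "f \<in> insert a G" for f
        using overring_mult[OF ov g(3)[OF that] gb] g(2) by simp
      moreover have "b / b \<in> V" using b overring_one[OF ov] by simp
      ultimately show ?thesis using b by (intro bexI[of _ b]) auto
    qed
  qed
  from this[OF F(1)] obtain g where "g \<in> insert a F" "g \<noteq> 0" "\<forall>f\<in>insert a F. f / g \<in> V" by blast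
  then show ?thesis using that[of g] F(2) by auto
qed

section \<open>The t- and w-closures in a PvMD\<close>

lemma common_denominator:
  assumes M: "M \<in> t_Max R" and E: "rmod E" and "finite A" "\<And>a. a \<in> A \<Longrightarrow> f a \<in> lext E M"
  shows "\<exists>s. s \<in> R \<and> s \<notin> M \<and> (\<forall>a\<in>A. s * f a \<in> E)"
  using assms(3,4)
proof (induction A rule: finite_induct)
  case empty
  then show ?case using t_Max_one[OF M] by blast
next
  case (insert b A)
  then obtain s where s: "s \<in> R" "s \<notin> M" "\<And>a. a \<in> A \<Longrightarrow> s * f a \<in> E" by auto
  obtain t where t: "t \<in> R" "t \<notin> M" "t * f b \<in> E" using insert.prems[of b] by (auto simp: lext_def)
  have "(s * t) * f a \<in> E" if "a \<in> insert b A" for a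
  proof (cases "a = b")
    case True
    then show ?thesis using rmod_mult[OF E s(1) t(3)] by (simp add: mult.assoc)
  next
    case False
    then show ?thesis using rmod_mult[OF E t(1) s(3)[of a]] that by (simp add: mult_ac)
  qed
  then show ?case using s t t_Max_mult_notin[OF M] by (intro exI[of _ "s * t"]) auto
qed

text \<open>At M one element g divides the whole finite set in R_M, so for a common denominator s
  the element s/g multiplies the set into R. It then does the same to x, and s x is in gR
  \<subseteq> I.\<close>

lemma PvMD_t_op_subset_w_op:
  assumes P: "PvMD R" and I: "submod R I"
  shows "t_op R I \<subseteq> w_op R I"
proof
  fix x assume "x \<in> t_op R I"
  then obtain F where F: "finite F" "F \<subseteq> I" "x \<in> v_op R F" using t_op_iff[OF I] by meson
  have mod: "rmod I" using I submod_rmod by blast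
  obtain a where a: "a \<in> I" "a \<noteq> 0" using submod_nonzero[OF I] .
  let ?G = "insert a F"
  have xG: "x \<in> v_op R ?G" using F(3) v_op_mono[of F ?G] by auto
  have "x \<in> lext I M" if M: "M \<in> t_Max R" for M
  proof -
    obtain g where g: "g \<in> ?G" "g \<noteq> 0" "\<And>f. f \<in> ?G \<Longrightarrow> f / g \<in> loc R M"
      using valuation_overring_dominating[OF PvMD_loc[OF P M], of ?G a] F(1) a(2) by auto
    obtain s where s: "s \<in> R" "s \<notin> M" "\<And>f. f \<in> ?G \<Longrightarrow> s * (f / g) \<in> R"
      using common_denominator[OF M rmod_R, of ?G "\<lambda>f. f / g"] g(3) F(1) lext_R[OF M] by auto
    have "x * (s / g) \<in> R" by (rule v_op_memD[OF xG]) (use s(3) in simp)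
    moreover have "g \<in> I" using g(1) a F(2) by auto
    ultimately have "(x * (s / g)) * g \<in> I" using rmod_mult[OF mod] by blast
    then have "s * x \<in> I" using g(2) by (simp add: mult_ac)
    then show ?thesis using s lextI by blast
  qed
  then show "x \<in> w_op R I" using w_op_iff[OF mod] by blast
qed

lemma PvMD_w_op_eq_t_op: "PvMD R \<Longrightarrow> submod R I \<Longrightarrow> w_op R I = t_op R I"
  using PvMD_t_op_subset_w_op w_op_subset_t_op by (metis subset_antisym)

text \<open>Since Q R_M meets R only in Q, the ideal is w-closed, and in a PvMD the w- and
  t-closures agree.\<close>

lemma prime_below_t_Max:
  assumes P: "PvMD R" and Q: "prime_ideal R Q" and M: "M \<in> t_Max R" "Q \<subseteq> M"
  shows "t_prime R Q"
proof -
  have int: "int_ideal R Q" and sm: "submod R Q" and QR: "Q \<subseteq> R"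
    using Q by (auto simp: prime_ideal_def int_ideal_def)
  have mod: "rmod Q" using sm submod_rmod by blast
  have "x \<in> Q" if x: "x \<in> w_op R Q" for x
  proof -
    have "x \<in> lext R N" if "N \<in> t_Max R" for N
      using x that w_op_iff[OF mod] lext_mono[OF QR] by blast
    then have "x \<in> R" using in_R_if_loc lext_R by blast
    moreover obtain s where "s \<in> R" "s \<notin> M" "s * x \<in> Q"
      using x M(1) w_op_iff[OF mod] by (auto simp: lext_def)
    ultimately show ?thesis using Q M(2) unfolding prime_ideal_def by blast
  qed
  then have "t_op R Q = Q"
    using PvMD_w_op_eq_t_op[OF P sm] t_op_increasing[OF sm] by blast
  then show ?thesis using Q int_ideal_frac[OF int] by (simp add: t_prime_def t_ideal_def)
qed

text \<open>If x is not in R_M, then 1/x is. Dividing the equation by x^(n-1) expresses x as a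
  polynomial in 1/x over R, which lies in R_M after all.\<close>

lemma PvMD_integrally_closed:
  assumes P: "PvMD R"
  shows "integrally_closed R"
  unfolding integrally_closed_def
proof (intro allI impI)
  fix x assume "\<exists>n::nat. \<exists>c. n > 0 \<and> (\<forall>i<n. c i \<in> R) \<and> x ^ n + (\<Sum>i<n. c i * x ^ i) = 0"
  then obtain n :: nat and c where nc: "n > 0" "\<And>i. i < n \<Longrightarrow> c i \<in> R"
    "x ^ n + (\<Sum>i<n. c i * x ^ i) = 0" by blast
  show "x \<in> R"
  proof (rule in_R_if_loc, rule ccontr)
    fix M assume M: "M \<in> t_Max R" and x: "x \<notin> loc R M"
    have V: "valuation_overring (loc R M)" using PvMD_loc[OF P M] .
    have ov: "overring (loc R M)" using overring_loc[OF M] .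
    have x0: "x \<noteq> 0" using x overring_zero[OF ov] by auto
    let ?y = "1 / x"
    have y: "?y \<in> loc R M" using valuation_overring_cases[OF V x0, of 1] x by auto
    obtain m where m: "n = Suc m" using nc(1) by (cases n) auto
    have "x ^ i * ?y ^ m = ?y ^ (m - i)" if "i < n" for i
    proof -
      have "?y ^ m = ?y ^ (m - i) * ?y ^ i" using that m by (simp flip: power_add)
      then show ?thesis using x0 by (simp add: power_one_over)
    qed
    then have "(\<Sum>i<n. c i * x ^ i) * ?y ^ m = (\<Sum>i<n. c i * ?y ^ (m - i))"
      by (simp add: sum_distrib_right mult.assoc)
    moreover have "x ^ n * ?y ^ m = x" using m x0 by (simp add: power_one_over)
    moreover have "x ^ n * ?y ^ m + (\<Sum>i<n. c i * x ^ i) * ?y ^ m = 0"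
      using nc(3) by (metis distrib_right mult_zero_left)
    ultimately have "x = - (\<Sum>i<n. c i * ?y ^ (m - i))"
      by (simp add: eq_neg_iff_add_eq_0)
    also have "\<dots> = (- 1) * (\<Sum>i<n. c i * ?y ^ (m - i))" by simp
    also have "\<dots> \<in> loc R M"
      using nc(2) R_subset_loc[OF M] overring_power[OF ov y]
      by (intro rmod_mult[OF loc_rmod[OF M]] rmod_sum[OF loc_rmod[OF M]]) (auto intro: loc_mult[OF M])
    finally show False using x by simp
  qed
qed

section \<open>Consequences of w-stability\<close>

lemma w_op_w_ideal:
  assumes J: "int_ideal R J"
  shows "w_ideal R (w_op R J)" "w_op R J \<subseteq> R"
proof -
  have mod: "rmod J" and JR: "J \<subseteq> R" using J submod_rmod by (auto simp: int_ideal_def)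
  note wmod = w_op_rmod[OF mod]
  show sub: "w_op R J \<subseteq> R"
  proof
    fix x assume "x \<in> w_op R J"
    then have "x \<in> lext R M" if "M \<in> t_Max R" for M
      using that w_op_iff[OF mod] lext_mono[OF JR] by blast
    then show "x \<in> R" using in_R_if_loc lext_R by blast
  qed
  obtain a where "a \<in> J" "a \<noteq> 0" using J submod_nonzero unfolding int_ideal_def by blast
  then have "submod R (w_op R J)" using rmod_submod[OF wmod] w_op_increasing[OF mod] by blast
  then have "frac_ideal R (w_op R J)" using sub int_ideal_frac by (simp add: int_ideal_def)
  then show "w_ideal R (w_op R J)"
  proof (rule w_idealI)
    fix z assume z: "\<And>M. M \<in> t_Max R \<Longrightarrow> z \<in> lext (w_op R J) M"
    show "z \<in> w_op R J"
      unfolding w_op_iff[OF mod] using z w_op_lext[OF mod] by blast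
  qed
qed

lemma Eend_overring:
  assumes "rmod I" shows "overring (Eend I)"
  unfolding overring_def Eend_def colon_def
  using assms by (simp add: rmod_def distrib_right mult.assoc subset_iff)

text \<open>For \<open>x = a / b\<close> and \<open>I = (a, b)\<^sub>w\<close> the determinant trick and integral closedness give
  \<open>E(I) = R\<close>, so stability makes \<open>I\<close> locally invertible.\<close>

lemma integrally_closed_w_stable_PvMD:
  assumes ic: "integrally_closed R" and st: "w_stable R"
  shows "PvMD R"
  unfolding PvMD_def valuation_subring_def
proof (intro ballI allI impI)
  fix M and x :: 'a assume M: "M \<in> t_Max R" and x0: "x \<noteq> 0"
  obtain a b where ab: "a \<in> R" "b \<in> R" "b \<noteq> 0" "x = a / b" using R_fraction .
  have a0: "a \<noteq> 0" using x0 ab by auto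
  define J where "J = {r * a + r' * b | r r'. r \<in> R \<and> r' \<in> R}"
  have aJ: "a \<in> J" unfolding J_def by (rule CollectI, rule exI[of _ 1], rule exI[of _ 0]) auto
  have bJ: "b \<in> J" unfolding J_def by (rule CollectI, rule exI[of _ 0], rule exI[of _ 1]) auto
  have modJ: "rmod J"
  proof (rule rmodI)
    show "0 \<in> J" unfolding J_def by (rule CollectI, rule exI[of _ 0], rule exI[of _ 0]) auto
    show "u + v \<in> J" if uv: "u \<in> J" "v \<in> J" for u v
    proof -
      obtain r r' s s' where "u = r * a + r' * b" "r \<in> R" "r' \<in> R" "v = s * a + s' * b" "s \<in> R" "s' \<in> R"
        using uv unfolding J_def by blast
      then have "u + v = (r + s) * a + (r' + s') * b" "r + s \<in> R" "r' + s' \<in> R"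
        by (auto simp: algebra_simps)
      then show ?thesis unfolding J_def by blast
    qed
    show "t * u \<in> J" if t: "t \<in> R" and u: "u \<in> J" for t u
    proof -
      obtain r r' where "u = r * a + r' * b" "r \<in> R" "r' \<in> R" using u unfolding J_def by blast
      then have "t * u = (t * r) * a + (t * r') * b" "t * r \<in> R" "t * r' \<in> R"
        using t by (auto simp: algebra_simps)
      then show ?thesis unfolding J_def by blast
    qed
  qed
  have "J \<subseteq> R" unfolding J_def using ab by auto
  then have J: "int_ideal R J" using rmod_submod[OF modJ aJ a0] by (simp add: int_ideal_def)
  define I where "I = w_op R J"
  have I: "w_ideal R I" "I \<subseteq> R" unfolding I_def using w_op_w_ideal[OF J] by auto
  have modI: "rmod I" using w_ideal_rmod[OF I(1)] .
  have JI: "J \<subseteq> I" unfolding I_def using w_op_increasing[OF modJ] .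
  have lextIJ: "z \<in> lext J N" if "z \<in> I" "N \<in> t_Max R" for z N
    using that w_op_iff[OF modJ] unfolding I_def by blast
  have "Eend I \<subseteq> R"
  proof
    fix y assume y: "y \<in> Eend I"
    show "y \<in> R"
    proof (rule in_R_if_loc)
      fix N assume N: "N \<in> t_Max R"
      \<comment> \<open>Elements of \<open>I\<close> are only locally in \<open>J\<close>, so
        integrality is proved for \<open>s * y\<close> with a denominator \<open>s\<close> outside
        \<open>N\<close>; this still gives \<open>y \<in> loc R N\<close>.\<close>
      have "y * f \<in> lext J N" if "f \<in> {a, b}" for f
        using lextIJ[OF _ N] colonD[of y I I f] y that aJ bJ JI by (auto simp: Eend_def)
      then obtain s where s: "s \<in> R" "s \<notin> N" "\<forall>f\<in>{a, b}. s * (y * f) \<in> J"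
        using common_denominator[OF N modJ, of "{a, b}" "\<lambda>f. y * f"] by auto
      then obtain p q p' q' where pq: "p \<in> R" "q \<in> R" "s * (y * a) = p * a + q * b"
        "p' \<in> R" "q' \<in> R" "s * (y * b) = p' * a + q' * b"
        unfolding J_def by auto
      let ?z = "s * y"
      have "(?z - p) * a = q * b" "(?z - q') * b = p' * a" using pq by (auto simp: algebra_simps)
      then have "((?z - p) * a) * ((?z - q') * b) = (q * b) * (p' * a)" by simp
      then have "((?z - p) * (?z - q') - q * p') * (a * b) = 0" by (simp add: algebra_simps)
      then have det: "(?z - p) * (?z - q') - q * p' = 0" using a0 ab(3) by simp
      \<comment> \<open>Coefficients of the characteristic polynomial of the matrix by which
        \<open>s * y\<close> acts on \<open>a\<close>, \<open>b\<close>: the determinant, and minus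
        the trace.\<close>
      define c where "c i = (if i = 0 then p * q' - q * p' else - (p + q'))" for i :: nat
      have "(\<Sum>i<2. c i * ?z ^ i) = p * q' - q * p' - (p + q') * ?z"
        by (simp add: numeral_2_eq_2 c_def algebra_simps)
      then have "?z ^ 2 + (\<Sum>i<2. c i * ?z ^ i) = (?z - p) * (?z - q') - q * p'"
        by (simp add: algebra_simps power2_eq_square)
      then have eq: "?z ^ 2 + (\<Sum>i<2. c i * ?z ^ i) = 0" using det by simp
      have cR: "\<forall>i<2. c i \<in> R" using pq by (auto simp: c_def)
      have "\<exists>n::nat. \<exists>c. n > 0 \<and> (\<forall>i<n. c i \<in> R) \<and> ?z ^ n + (\<Sum>i<n. c i * ?z ^ i) = 0"
        by (rule exI[of _ 2], rule exI[of _ c]) (use eq cR in simp)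
      then have "?z \<in> R" using ic unfolding integrally_closed_def by blast
      then show "y \<in> loc R N" using s loc_iff[OF N] by blast
    qed
  qed
  then have EI: "Eend I = R" using overring_R[OF Eend_overring[OF modI]] by blast
  have "w_op R (smod_prod I (colon R I)) = R"
    using st I(1) EI unfolding w_stable_def by metis
  then have "1 \<in> lext (smod_prod I (colon R I)) M"
    using w_op_iff[OF rmod_smod_prod[OF modI]] M by (metis R_one)
  then obtain s where s: "s \<notin> M" "s \<in> smod_prod I (colon R I)" by (auto simp: lext_def)
  have "\<exists>i\<in>I. \<exists>e\<in>colon R I. i * e \<notin> M"
  proof (rule ccontr)
    assume "\<not> ?thesis"
    then have "smod_prod I (colon R I) \<subseteq> M"
      by (intro smod_prod_least t_Max_rmod M) blast
    then show False using s by blast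
  qed
  then obtain i e where ie: "i \<in> I" "e \<in> colon R I" "i * e \<notin> M" by blast
  have eR: "f * e \<in> R" if "f \<in> I" for f using colonD[OF ie(2) that] by (simp add: mult.commute)
  obtain t where t: "t \<in> R" "t \<notin> M" "t * i \<in> J" using lextIJ[OF ie(1) M] by (auto simp: lext_def)
  then obtain r r' where r: "r \<in> R" "r' \<in> R" "t * i = r * a + r' * b" unfolding J_def by blast
  have "t * (i * e) \<notin> M" using t_Max_mult_notin[OF M t(1,2) eR[OF ie(1)] ie(3)] .
  moreover have "t * (i * e) = r * (a * e) + r' * (b * e)"
    using r(3) by (metis distrib_right mult.assoc)
  \<comment> \<open>Both products are in R and their quotient is x, so the one outside M decides
    which of x and its inverse is in R_M.\<close>
  ultimately have "a * e \<notin> M \<or> b * e \<notin> M"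
    using rmod_add[OF t_Max_rmod[OF M]] rmod_mult[OF t_Max_rmod[OF M]] r(1,2) by metis
  moreover have aeR: "a * e \<in> R" and beR: "b * e \<in> R" using eR aJ bJ JI by auto
  moreover have "inverse x \<in> loc R M" if "a * e \<notin> M"
  proof -
    have "(b * e) / (a * e) \<in> loc R M" unfolding loc_def using that aeR beR by blast
    moreover have "e \<noteq> 0" using that t_Max_zero[OF M] by auto
    ultimately show ?thesis using ab by simp
  qed
  moreover have "x \<in> loc R M" if "b * e \<notin> M"
  proof -
    have "(a * e) / (b * e) \<in> loc R M" unfolding loc_def using that aeR beR by blast
    moreover have "e \<noteq> 0" using that t_Max_zero[OF M] by auto
    ultimately show ?thesis using ab by simp
  qed
  ultimately show "x \<in> loc R M \<or> inverse x \<in> loc R M" by blast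
qed

text \<open>At M \<supseteq> Q idempotence replaces Q by Q^2, while Q^2 (E(Q):Q) \<subseteq> Q E(Q)
  = Q \<subseteq> M. Stability, however, provides an element of Q (E(Q):Q) outside M.\<close>

lemma w_stable_PvMD_strongly_discrete:
  assumes st: "w_stable R" and P: "PvMD R"
  shows "strongly_discrete_PvMD R"
  unfolding strongly_discrete_PvMD_def
proof (intro conjI allI impI notI P)
  fix Q assume Q: "t_prime R Q" and idem: "t_op R (smod_prod Q Q) = Q"
  have int: "int_ideal R Q" and ti: "t_ideal R Q" and "Q \<noteq> R"
    using Q by (auto simp: t_prime_def prime_ideal_def)
  then obtain M where M: "M \<in> t_Max R" "Q \<subseteq> M" using t_Max_exists by blast
  have modQ: "rmod Q" using int submod_rmod by (simp add: int_ideal_def)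
  obtain q where q: "q \<in> Q" "q \<noteq> 0" using int submod_nonzero unfolding int_ideal_def by blast
  have modQQ: "rmod (smod_prod Q Q)" using rmod_smod_prod[OF modQ] .
  have smQQ: "submod R (smod_prod Q Q)"
    using rmod_submod[OF modQQ smod_prod_mem[OF q(1) q(1)]] q(2) by simp
  have QQ: "a \<in> lext (smod_prod Q Q) M" if "a \<in> Q" for a
    using that idem PvMD_w_op_eq_t_op[OF P smQQ] w_op_iff[OF modQQ] M(1) by blast
  let ?C = "colon (Eend Q) Q"
  have "w_op R (smod_prod Q ?C) = Eend Q"
    using st t_ideal_w_ideal[OF ti] unfolding w_stable_def by blast
  moreover have "1 \<in> Eend Q" by (auto simp: Eend_def colon_def)
  ultimately have "1 \<in> lext (smod_prod Q ?C) M"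
    using w_op_iff[OF rmod_smod_prod[OF modQ]] M(1) by blast
  then obtain s where s: "s \<in> R" "s \<notin> M" "s \<in> smod_prod Q ?C" by (auto simp: lext_def)
  then obtain n :: nat and a e where ae: "s = (\<Sum>i<n. a i * e i)" "\<And>i. i < n \<Longrightarrow> a i \<in> Q \<and> e i \<in> ?C"
    unfolding smod_prod_def by blast
  obtain t where t: "t \<in> R" "t \<notin> M" "\<And>i. i < n \<Longrightarrow> t * a i \<in> smod_prod Q Q"
    using common_denominator[OF M(1) modQQ, of "{..<n}" a] QQ ae(2) by auto
  have "b * e i \<in> Q" if b: "b \<in> smod_prod Q Q" and i: "i < n" for b i
  proof -
    have "smod_prod Q Q \<subseteq> {b. b * e i \<in> Q}"
    proof (rule smod_prod_least)
      show "rmod {b. b * e i \<in> Q}"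
        by (rule rmodI) (auto simp: distrib_right mult.assoc intro: rmod_zero[OF modQ] rmod_add[OF modQ] rmod_mult[OF modQ])
      fix u v assume uv: "u \<in> Q" "v \<in> Q"
      have "e i * v \<in> Eend Q" using ae(2)[OF i] uv(2) colonD by blast
      then have "(e i * v) * u \<in> Q" using uv(1) colonD unfolding Eend_def by blast
      then show "u * v \<in> {b. b * e i \<in> Q}" by (simp add: mult_ac)
    qed
    then show ?thesis using b by blast
  qed
  then have "(\<Sum>i<n. (t * a i) * e i) \<in> Q" using t(3) by (intro rmod_sum[OF modQ]) auto
  moreover have "t * s = (\<Sum>i<n. (t * a i) * e i)" using ae(1) by (simp add: sum_distrib_left mult.assoc)
  ultimately have "t * s \<in> M" using M(2) by auto
  then show False using t_Max_mult_notin[OF M(1) t(1,2) s(1,2)] by blast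
qed

section \<open>w-divisorial domains\<close>

text \<open>Because 1 is not in M_v, some y in (R:M) is outside R. For L \<noteq> M any element of M
  outside L is a denominator of y, so y can fail only at M.\<close>

lemma w_divisorial_separating:
  assumes wD: "w_divisorial R" and M: "M \<in> t_Max R"
  obtains y where "y \<notin> loc R M" "\<And>L. L \<in> t_Max R \<Longrightarrow> L \<noteq> M \<Longrightarrow> y \<in> loc R L"
    "\<And>m. m \<in> M \<Longrightarrow> y * m \<in> R"
proof -
  have "v_op R M = M"
    using wD t_ideal_w_ideal[OF t_Max_t_ideal[OF M]] unfolding w_divisorial_def divisorial_def by blast
  then have "1 \<notin> v_op R M" using t_Max_one[OF M] by simp
  then obtain y where y: "y \<in> colon R M" "y \<notin> R" by (auto simp: v_op_def colon_def)
  have yM: "y * m \<in> R" if "m \<in> M" for m using colonD[OF y(1) that] .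
  have yL: "y \<in> loc R L" if L: "L \<in> t_Max R" "L \<noteq> M" for L
  proof -
    obtain s where s: "s \<in> M" "s \<notin> L" "s \<in> R" using t_Max_incomparable[OF M L(1)] L(2) by metis
    then show ?thesis using yM[of s] loc_iff[OF L(1)] by (metis mult.commute)
  qed
  have "y \<notin> loc R M"
  proof
    assume "y \<in> loc R M"
    then have "y \<in> R" using in_R_if_loc[of y] yL by metis
    then show False using y(2) by blast
  qed
  then show ?thesis using that yL yM by blast
qed

text \<open>Otherwise the ideal C of elements of R common to all members of S is inside N. The
  w-ideal B = R_N \<inter> (R:C) contains 1 and the separating elements of all M in S, so whatever
  multiplies B into R lies in C \<subseteq> N. A separating element of N is then in the v-closure of
  B but not in R_N.\<close>

lemma w_divisorial_inter_not_subset: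
  assumes wD: "w_divisorial R" and x: "x \<in> R" "x \<noteq> 0"
    and S: "S \<subseteq> t_Max R" "\<And>M. M \<in> S \<Longrightarrow> x \<in> M" and N: "N \<in> t_Max R" "N \<notin> S"
  shows "\<exists>c\<in>R. (\<forall>M\<in>S. c \<in> M) \<and> c \<notin> N"
proof (rule ccontr)
  assume neg: "\<not> ?thesis"
  define C where "C = {c \<in> R. \<forall>M\<in>S. c \<in> M}"
  have CN: "C \<subseteq> N" using neg unfolding C_def by blast
  have xC: "x \<in> C" using x S unfolding C_def by blast
  define B where "B = {z \<in> loc R N. \<forall>c\<in>C. z * c \<in> R}"
  have BN: "B \<subseteq> loc R N" unfolding B_def by blast
  have oneB: "1 \<in> B" unfolding B_def C_def using R_subset_loc[OF N(1)] by auto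
  have modB: "rmod B"
    unfolding B_def
    by (rule rmodI) (auto simp: distrib_right mult.assoc intro: rmod_zero[OF loc_rmod[OF N(1)]]
        rmod_add[OF loc_rmod[OF N(1)]] rmod_mult[OF loc_rmod[OF N(1)]])
  have "frac_ideal R B"
    unfolding frac_ideal_def
  proof
    show "submod R B" using rmod_submod[OF modB oneB] by simp
    show "\<exists>d\<in>R. d \<noteq> 0 \<and> (\<forall>z\<in>B. d * z \<in> R)"
    proof (intro bexI[of _ x] conjI ballI x)
      fix z assume "z \<in> B"
      then show "x * z \<in> R" using xC unfolding B_def by (auto simp: mult.commute)
    qed
  qed
  then have "w_ideal R B"
  proof (rule w_idealI)
    fix z assume z: "\<And>M. M \<in> t_Max R \<Longrightarrow> z \<in> lext B M"
    have "z \<in> loc R N"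
    proof -
      obtain s where s: "s \<in> R" "s \<notin> N" "s * z \<in> loc R N" using z[OF N(1)] BN by (auto simp: lext_def)
      have "(1 / s) * (s * z) \<in> loc R N" using loc_mult[OF N(1) loc_inverse[OF N(1) s(1,2)] s(3)] .
      moreover have "s \<noteq> 0" using s t_Max_zero[OF N(1)] by auto
      ultimately show ?thesis by simp
    qed
    moreover have "z * c \<in> R" if c: "c \<in> C" for c
    proof (rule in_R_if_loc)
      fix M assume M: "M \<in> t_Max R"
      obtain s where s: "s \<in> R" "s \<notin> M" "s * z \<in> B" using z[OF M] by (auto simp: lext_def)
      then have "s * (z * c) \<in> R" using c unfolding B_def by (auto simp: mult.assoc)
      then show "z * c \<in> loc R M" using s loc_iff[OF M] by blast
    qed
    ultimately show "z \<in> B" unfolding B_def by blast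
  qed
  then have vB: "v_op R B = B" using wD unfolding w_divisorial_def divisorial_def by blast
  obtain y where y: "y \<notin> loc R N" "\<And>m. m \<in> N \<Longrightarrow> y * m \<in> R"
    using w_divisorial_separating[OF wD N(1)] by metis
  have "y \<in> v_op R B"
  proof (rule v_op_memI)
    fix r assume r: "\<And>z. z \<in> B \<Longrightarrow> r * z \<in> R"
    have rR: "r \<in> R" using r[OF oneB] by simp
    have "r \<in> M" if M: "M \<in> S" for M
    proof (rule ccontr)
      assume rM: "r \<notin> M"
      have Mt: "M \<in> t_Max R" using M S by blast
      obtain u where u: "u \<notin> loc R M" "\<And>L. L \<in> t_Max R \<Longrightarrow> L \<noteq> M \<Longrightarrow> u \<in> loc R L"
        "\<And>m. m \<in> M \<Longrightarrow> u * m \<in> R"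
        using w_divisorial_separating[OF wD Mt] by metis
      have "N \<noteq> M" using M N by auto
      then have "u \<in> B" unfolding B_def C_def using u(2)[OF N(1)] u(3) M by auto
      then have "r * u \<in> R" using r by blast
      then show False using u(1) loc_iff[OF Mt] rR rM by blast
    qed
    then have "r \<in> N" using CN rR unfolding C_def by blast
    then show "y * r \<in> R" using y(2) by blast
  qed
  then show False using vB BN y(1) by blast
qed

text \<open>The elements of R lying in almost all members of an infinite S form a proper t-ideal D,
  contained in some N. The preceding lemma for S without N gives an element of D outside N.\<close>

lemma w_divisorial_finite_character:
  assumes wD: "w_divisorial R" and x: "x \<in> R" "x \<noteq> 0"
  shows "finite {M \<in> t_Max R. x \<in> M}"
proof (rule ccontr)
  define S where "S = {M \<in> t_Max R. x \<in> M}"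
  assume "infinite {M \<in> t_Max R. x \<in> M}"
  then have inf: "infinite S" by (simp add: S_def)
  have St: "M \<in> t_Max R" if "M \<in> S" for M using that by (simp add: S_def)
  define D where "D = {r \<in> R. finite {M \<in> S. r \<notin> M}}"
  have "rmod D"
  proof (rule rmodI)
    have "finite {M \<in> S. 0 \<notin> M}" using t_Max_zero[OF St] by (simp cong: conj_cong)
    then show "0 \<in> D" unfolding D_def by simp
    show "u + v \<in> D" if uv: "u \<in> D" "v \<in> D" for u v
    proof -
      have "{M \<in> S. u + v \<notin> M} \<subseteq> {M \<in> S. u \<notin> M} \<union> {M \<in> S. v \<notin> M}"
        using rmod_add[OF t_Max_rmod[OF St]] by blast
      then show ?thesis using uv unfolding D_def by (auto intro: finite_subset)
    qed
    show "r * v \<in> D" if "r \<in> R" "v \<in> D" for r v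
    proof -
      have "{M \<in> S. r * v \<notin> M} \<subseteq> {M \<in> S. v \<notin> M}"
        using rmod_mult[OF t_Max_rmod[OF St]] that(1) by blast
      then show ?thesis using that unfolding D_def by (auto intro: finite_subset)
    qed
  qed
  moreover have "x \<in> D" unfolding D_def S_def using x by simp
  ultimately have int: "int_ideal R D"
    using rmod_submod x(2) unfolding int_ideal_def D_def by blast
  have "t_ideal R D"
    unfolding t_ideal_iff[OF int_ideal_frac[OF int]]
  proof (intro allI impI subsetI)
    fix F z assume F: "finite F \<and> F \<subseteq> D" and z: "z \<in> v_op R F"
    have "z * 1 \<in> R" by (rule v_op_memD[OF z]) (use F in \<open>auto simp: D_def\<close>)
    moreover have "{M \<in> S. z \<notin> M} \<subseteq> (\<Union>f\<in>F. {M \<in> S. f \<notin> M})"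
      using t_Max_v_op[OF St, of _ F] F z by blast
    moreover have "finite (\<Union>f\<in>F. {M \<in> S. f \<notin> M})" using F by (auto simp: D_def)
    ultimately show "z \<in> D" unfolding D_def by (auto intro: finite_subset)
  qed
  moreover have "1 \<notin> D"
  proof
    assume "1 \<in> D"
    moreover have "{M \<in> S. 1 \<notin> M} = S" using t_Max_one[OF St] by blast
    ultimately show False using inf unfolding D_def by simp
  qed
  ultimately obtain N where N: "N \<in> t_Max R" "D \<subseteq> N"
    using t_Max_exists[OF int] R_one by metis
  have "\<exists>c\<in>R. (\<forall>M\<in>S - {N}. c \<in> M) \<and> c \<notin> N"
    by (rule w_divisorial_inter_not_subset[OF wD x _ _ N(1)]) (auto simp: S_def)
  then obtain c where c: "c \<in> R" "\<forall>M\<in>S - {N}. c \<in> M" "c \<notin> N" by blast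
  have "{M \<in> S. c \<notin> M} \<subseteq> {N}" using c(2) by blast
  then have "c \<in> D" unfolding D_def using c(1) finite_subset by auto
  then show False using c(3) N(2) by blast
qed

text \<open>The ring R_M R_N, as the localization of R at the products s t.\<close>

definition compositum :: "'a set \<Rightarrow> 'a set \<Rightarrow> 'a set" where
  "compositum M N = {z. \<exists>s t. s \<in> R \<and> s \<notin> M \<and> t \<in> R \<and> t \<notin> N \<and> s * t * z \<in> R}"

lemma compositumI:
  "s \<in> R \<Longrightarrow> s \<notin> M \<Longrightarrow> t \<in> R \<Longrightarrow> t \<notin> N \<Longrightarrow> s * t * z \<in> R \<Longrightarrow> z \<in> compositum M N"
  unfolding compositum_def by blast

lemma
  assumes M: "M \<in> t_Max R" and N: "N \<in> t_Max R"
  shows loc_subset_compositum1: "loc R M \<subseteq> compositum M N"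
    and loc_subset_compositum2: "loc R N \<subseteq> compositum M N"
    and overring_compositum: "overring (compositum M N)"
proof -
  show 1: "loc R M \<subseteq> compositum M N"
  proof
    fix z assume "z \<in> loc R M"
    then obtain s where "s \<in> R" "s \<notin> M" "s * z \<in> R" using loc_iff[OF M] by blast
    then show "z \<in> compositum M N" using compositumI[of s M 1 N z] t_Max_one[OF N] by simp
  qed
  show "loc R N \<subseteq> compositum M N"
  proof
    fix z assume "z \<in> loc R N"
    then obtain s where "s \<in> R" "s \<notin> N" "s * z \<in> R" using loc_iff[OF N] by blast
    then show "z \<in> compositum M N" using compositumI[of 1 M s N z] t_Max_one[OF M] by simp
  qed
  show "overring (compositum M N)"
    unfolding overring_def
  proof (intro conjI ballI)
    show "R \<subseteq> compositum M N" using 1 R_subset_loc[OF M] by blast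
    fix x y assume "x \<in> compositum M N" "y \<in> compositum M N"
    then obtain s t u v where st: "s \<in> R" "s \<notin> M" "t \<in> R" "t \<notin> N" "s * t * x \<in> R"
      "u \<in> R" "u \<notin> M" "v \<in> R" "v \<notin> N" "u * v * y \<in> R"
      unfolding compositum_def by blast
    have su: "s * u \<in> R" "s * u \<notin> M" "t * v \<in> R" "t * v \<notin> N"
      using st t_Max_mult_notin[OF M] t_Max_mult_notin[OF N] by auto
    have "(s * u) * (t * v) * (x + y) = (u * v) * (s * t * x) + (s * t) * (u * v * y)"
      by (simp add: algebra_simps)
    also have "\<dots> \<in> R" using st by auto
    finally show "x + y \<in> compositum M N" using compositumI su by blast
    have "(s * u) * (t * v) * (x * y) = (s * t * x) * (u * v * y)"
      by (simp add: algebra_simps)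
    also have "\<dots> \<in> R" using st by blast
    finally show "x * y \<in> compositum M N" using compositumI su by blast
  qed
qed

text \<open>A nonzero prime below both M and N keeps R_M R_N away from K: none of its elements
  divides a product s t with s outside M and t outside N.\<close>

lemma inverse_notin_compositum:
  assumes P: "prime_ideal R P" "P \<subseteq> M" "P \<subseteq> N" and p: "p \<in> P" "p \<noteq> 0"
  shows "1 / p \<notin> compositum M N"
proof
  assume "1 / p \<in> compositum M N"
  then obtain s t where st: "s \<in> R" "s \<notin> M" "t \<in> R" "t \<notin> N" "s * t * (1 / p) \<in> R"
    unfolding compositum_def by blast
  have "rmod P" using P(1) submod_rmod by (simp add: prime_ideal_def int_ideal_def)
  then have "(s * t * (1 / p)) * p \<in> P" using rmod_mult[OF _ st(5) p(1)] by blast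
  then have "s * t \<in> P" using p(2) by simp
  then show False using st P unfolding prime_ideal_def by blast
qed

text \<open>Each N \<noteq> M offers its own s_N outside M with s_N/b in R_N. Only the finitely many
  N containing b need one, since otherwise 1/b is in R_N, and the product of these s_N is still
  outside M.\<close>

lemma uniform_denominator:
  assumes M: "M \<in> t_Max R" and b: "b \<in> R" "b \<noteq> 0" and fin: "finite {N \<in> t_Max R. b \<in> N}"
    and inv: "\<And>N. N \<in> t_Max R \<Longrightarrow> N \<noteq> M \<Longrightarrow> 1 / b \<in> compositum N M"
  obtains s where "s \<in> R" "s \<notin> M" "\<And>N. N \<in> t_Max R \<Longrightarrow> N \<noteq> M \<Longrightarrow> s / b \<in> loc R N"
proof -
  have "\<exists>s. s \<in> R \<and> s \<notin> M \<and> s / b \<in> loc R N" if N: "N \<in> t_Max R" "N \<noteq> M" for N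
  proof -
    obtain u s where "u \<in> R" "u \<notin> N" "s \<in> R" "s \<notin> M" "u * s * (1 / b) \<in> R"
      using inv[OF N] unfolding compositum_def by blast
    moreover then have "u * (s / b) \<in> R" by simp
    ultimately show ?thesis using loc_iff[OF N(1)] by blast
  qed
  then obtain f where f: "\<And>N. N \<in> t_Max R \<Longrightarrow> N \<noteq> M \<Longrightarrow> f N \<in> R \<and> f N \<notin> M \<and> f N / b \<in> loc R N"
    by metis
  define A where "A = {N \<in> t_Max R. b \<in> N} - {M}"
  have A: "finite A" using fin by (simp add: A_def)
  have fA: "f N \<in> R \<and> f N \<notin> M" if "N \<in> A" for N using that f by (auto simp: A_def)
  have s: "prod f A \<in> R" "prod f A \<notin> M" using t_Max_prod_notin[OF M A fA] by auto
  have "prod f A / b \<in> loc R N" if N: "N \<in> t_Max R" "N \<noteq> M" for N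
  proof (cases "b \<in> N")
    case True
    then have NA: "N \<in> A" using N by (simp add: A_def)
    have "prod f A / b = prod f (A - {N}) * (f N / b)"
      using prod.remove[OF A NA, of f] by (simp add: mult.commute)
    moreover have "prod f (A - {N}) \<in> R"
      using t_Max_prod_notin[OF M, of "A - {N}" f] A fA by auto
    ultimately show ?thesis using rmod_mult[OF loc_rmod[OF N(1)]] f[OF N] by metis
  next
    case False
    then have "prod f A * (1 / b) \<in> loc R N"
      using rmod_mult[OF loc_rmod[OF N(1)] s(1) loc_inverse[OF N(1) b(1)]] by blast
    then show ?thesis by simp
  qed
  then show ?thesis using that s by blast
qed

text \<open>Two \<open>t\<close>-maximal ideals \<open>L\<close> and \<open>N\<close> over a common \<open>t\<close>-prime, with \<open>T = R\<^sub>L R\<^sub>N\<close> as small as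
  possible, would make \<open>T \<inter> \<Inter>\<^bsub>M \<noteq> N\<^esub> R\<^sub>M\<close> a non-divisorial \<open>w\<close>-ideal: its inverse
  consists of non-units of \<open>T\<close>, hence its \<open>v\<close>-closure is not contained in \<open>R\<^sub>L\<close>.\<close>

lemma w_divisorial_t_prime_unique:
  assumes wD: "w_divisorial R" and P: "PvMD R" and Q: "t_prime R Q"
    and M: "M \<in> t_Max R" "Q \<subseteq> M" and N: "N \<in> t_Max R" "Q \<subseteq> N"
  shows "M = N"
proof (rule ccontr)
  assume MN: "M \<noteq> N"
  have prQ: "prime_ideal R Q" using Q by (simp add: t_prime_def)
  then have QR: "submod R Q" "Q \<subseteq> R" by (auto simp: prime_ideal_def int_ideal_def)
  obtain p where p: "p \<in> Q" "p \<noteq> 0" using submod_nonzero[OF QR(1)] .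
  have pR: "p \<in> R" using p(1) QR(2) by blast
  define W where "W = {L \<in> t_Max R. p \<in> L} - {N}"
  have finW: "finite W" unfolding W_def using w_divisorial_finite_character[OF wD pR p(2)] by simp
  have MW: "M \<in> W" using M MN p unfolding W_def by auto
  have V: "valuation_overring (loc R N)" using PvMD_loc[OF P N(1)] .
  obtain T where T: "T \<in> (\<lambda>L. compositum L N) ` W"
    "\<forall>T'\<in>(\<lambda>L. compositum L N) ` W. T' \<subseteq> T \<longrightarrow> T = T'"
    using finite_has_minimal[of "(\<lambda>L. compositum L N) ` W"] finW MW by blast
  then obtain L where L: "L \<in> W" "T = compositum L N" by blast
  have Lt: "L \<in> t_Max R" and LN: "L \<noteq> N" using L(1) by (auto simp: W_def)
  have ovT: "overring T" and LT: "loc R L \<subseteq> T" and NT: "loc R N \<subseteq> T"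
    using L(2) overring_compositum[OF Lt N(1)] loc_subset_compositum1[OF Lt N(1)]
      loc_subset_compositum2[OF Lt N(1)] by auto
  \<comment> \<open>Overrings of R_N form a chain, so the minimal \<open>T\<close> is below every
    compositum over \<open>W\<close>.\<close>
  have lin: "T \<subseteq> compositum K N \<or> compositum K N \<subseteq> T" if K: "K \<in> t_Max R" for K
    using overrings_linear[OF V ovT NT overring_compositum[OF K N(1)] loc_subset_compositum2[OF K N(1)]] .
  have TW: "T \<subseteq> compositum K N" if K: "K \<in> W" for K
    using lin[of K] T(2) K by (auto simp: W_def)
  have pT: "1 / p \<notin> T"
    using TW[OF MW] inverse_notin_compositum[OF prQ M(2) N(2) p] by blast
  \<comment> \<open>If \<open>p\<close> is not in \<open>K\<close>, then \<open>1 / p\<close> lies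
    in the compositum but not in \<open>T\<close>, which decides the comparison.\<close>
  have Tleast: "T \<subseteq> compositum K N" if K: "K \<in> t_Max R" "K \<noteq> N" for K
  proof (cases "p \<in> K")
    case True
    then show ?thesis using TW K by (simp add: W_def)
  next
    case False
    then have "1 / p \<in> compositum K N"
      using loc_inverse[OF K(1) pR] loc_subset_compositum1[OF K(1) N(1)] by blast
    then show ?thesis using lin[OF K(1)] pT by blast
  qed
  have nuN: "nonunits T \<subseteq> loc R N" using nonunits_subset[OF V NT] .
  have nuL: "nonunits T \<subseteq> loc R L" using nonunits_subset[OF PvMD_loc[OF P Lt] LT] .
  define I where "I = {z \<in> T. \<forall>K\<in>t_Max R. K \<noteq> N \<longrightarrow> z \<in> loc R K}"
  have RI: "R \<subseteq> I" unfolding I_def using overring_R[OF ovT] R_subset_loc by auto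
  have modI: "rmod I"
    unfolding I_def
    by (rule rmodI) (auto intro: rmod_zero[OF overring_rmod[OF ovT]] rmod_add[OF overring_rmod[OF ovT]]
        rmod_mult[OF overring_rmod[OF ovT]] rmod_zero[OF loc_rmod] rmod_add[OF loc_rmod] rmod_mult[OF loc_rmod])
  have "frac_ideal R I"
    unfolding frac_ideal_def
  proof
    show "submod R I" using rmod_submod[OF modI, of 1] RI by auto
    show "\<exists>d\<in>R. d \<noteq> 0 \<and> (\<forall>z\<in>I. d * z \<in> R)"
    \<comment> \<open>As a nonunit of \<open>T\<close>, \<open>p\<close> carries \<open>T\<close>
      into R_N, so it is a common denominator of \<open>I\<close>.\<close>
    proof (intro bexI[of _ p] conjI ballI p(2) pR)
      fix z assume z: "z \<in> I"
      show "p * z \<in> R"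
      proof (rule in_R_if_loc)
        fix K assume K: "K \<in> t_Max R"
        show "p * z \<in> loc R K"
        proof (cases "K = N")
          case True
          have "p \<in> nonunits T" using pT by (simp add: nonunits_def)
          then have "p * z \<in> nonunits T" using nonunits_mult[OF ovT] z unfolding I_def by blast
          then show ?thesis using True nuN by blast
        next
          case False
          then have "z \<in> loc R K" using z K unfolding I_def by blast
          then show ?thesis using rmod_mult[OF loc_rmod[OF K] pR] by blast
        qed
      qed
    qed
  qed
  then have "w_ideal R I"
  proof (rule w_idealI)
    fix z assume z: "\<And>K. K \<in> t_Max R \<Longrightarrow> z \<in> lext I K"
    have div: "z \<in> S" if S: "overring S" "K \<in> t_Max R" "loc R K \<subseteq> S" "I \<subseteq> S" for K S
    proof -
      obtain s where s: "s \<in> R" "s \<notin> K" "s * z \<in> I" using z[OF S(2)] by (auto simp: lext_def)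
      then have "(1 / s) * (s * z) \<in> S"
        using overring_mult[OF S(1)] loc_inverse[OF S(2) s(1,2)] S(3,4) by blast
      moreover have "s \<noteq> 0" using s t_Max_zero[OF S(2)] by auto
      ultimately show ?thesis by simp
    qed
    have "z \<in> T" using div[OF ovT N(1) NT] unfolding I_def by blast
    moreover have "z \<in> loc R K" if "K \<in> t_Max R" "K \<noteq> N" for K
      using div[OF overring_loc[OF that(1)] that(1)] that unfolding I_def by blast
    ultimately show "z \<in> I" unfolding I_def by blast
  qed
  then have vI: "v_op R I = I" using wD unfolding w_divisorial_def divisorial_def by blast
  obtain y where y: "y \<notin> loc R N" "\<And>K. K \<in> t_Max R \<Longrightarrow> K \<noteq> N \<Longrightarrow> y \<in> loc R K"
    using w_divisorial_separating[OF wD N(1)] by metis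
  obtain u where u: "u \<notin> loc R L" "\<And>K. K \<in> t_Max R \<Longrightarrow> K \<noteq> L \<Longrightarrow> u \<in> loc R K"
    using w_divisorial_separating[OF wD Lt] by metis
  have "u \<in> v_op R I"
  proof (rule v_op_memI)
    fix z assume z: "\<And>i. i \<in> I \<Longrightarrow> z * i \<in> R"
    have zR: "z \<in> R" using z[of 1] RI by auto
    \<comment> \<open>If z were a unit of T, some s outside N would make s/z integral away from N.
      As y is in R_L \<subseteq> T and fails only at N, y s/z would be in I, so s y = z (y s/z)
      would be in R and y in R_N.\<close>
    have zn: "z \<in> nonunits T"
    proof (rule ccontr)
      assume "z \<notin> nonunits T"
      then have z0: "z \<noteq> 0" and zT: "1 / z \<in> T" by (auto simp: nonunits_def)
      obtain s where s: "s \<in> R" "s \<notin> N" "\<And>K. K \<in> t_Max R \<Longrightarrow> K \<noteq> N \<Longrightarrow> s / z \<in> loc R K"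
        using uniform_denominator[OF N(1) zR z0 w_divisorial_finite_character[OF wD zR z0]] zT Tleast
        by (metis subsetD)
      have "y * (s / z) \<in> loc R K" if "K \<in> t_Max R" "K \<noteq> N" for K
        using loc_mult[OF that(1) y(2)[OF that] s(3)[OF that]] .
      moreover have "y * (s / z) \<in> T"
        using overring_mult[OF ovT, of y "s / z"] overring_mult[OF ovT, of s "1 / z"]
          y(2)[OF Lt LN] LT s(1) overring_R[OF ovT] zT by auto
      ultimately have "y * (s / z) \<in> I" unfolding I_def by blast
      then have "s * y \<in> R" using z[of "y * (s / z)"] z0 by (simp add: mult_ac)
      then show False using y(1) s loc_iff[OF N(1)] by blast
    qed
    show "u * z \<in> R"
    proof (rule in_R_if_loc)
      fix K assume K: "K \<in> t_Max R"
      show "u * z \<in> loc R K"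
      proof (cases "K = L")
        case True
        \<comment> \<open>\<open>u\<close> fails only at \<open>L\<close>, and there the nonunit
          \<open>z\<close> of \<open>T\<close> repairs it.\<close>
        have "u \<in> T" using u(2)[OF N(1)] LN NT by blast
        then have "z * u \<in> nonunits T" using nonunits_mult[OF ovT zn] by blast
        then show ?thesis using True nuL by (auto simp: mult.commute)
      next
        case False
        then show ?thesis using loc_mult[OF K u(2)[OF K]] zR R_subset_loc[OF K] by blast
      qed
    qed
  qed
  then show False using vI u(1) Lt LN unfolding I_def by blast
qed

lemma w_divisorial_PvMD_weakly_Matlis:
  assumes "w_divisorial R" "PvMD R"
  shows "weakly_Matlis R"
  unfolding weakly_Matlis_def
proof (intro conjI ballI impI allI)
  fix x assume "x \<in> R" "x \<noteq> 0"
  then show "finite {M \<in> t_Max R. x \<in> M}" using w_divisorial_finite_character[OF assms(1)] by blast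
next
  fix Q assume Q: "t_prime R Q"
  then obtain M where "M \<in> t_Max R" "Q \<subseteq> M"
    using t_Max_exists[of Q] unfolding t_prime_def prime_ideal_def by blast
  then show "\<exists>!M. M \<in> t_Max R \<and> Q \<subseteq> M"
    using w_divisorial_t_prime_unique[OF assms Q] by blast
qed

section \<open>Weakly Matlis strongly discrete PvMDs\<close>

text \<open>The center of T on R. It is nonzero because the denominator of an element outside T is
  not invertible in T, and as a prime inside M it is automatically a t-prime.\<close>

lemma nonunits_t_prime:
  assumes P: "PvMD R" and M: "M \<in> t_Max R" and T: "overring T" "loc R M \<subseteq> T" "T \<noteq> UNIV"
  shows "t_prime R (nonunits T \<inter> R)" "nonunits T \<inter> R \<subseteq> M"
proof -
  let ?Q = "nonunits T \<inter> R"
  note V = PvMD_loc[OF P M]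
  have "rmod ?Q"
  proof (rule rmodI)
    show "0 \<in> ?Q" by (simp add: nonunits_def)
    show "x + y \<in> ?Q" if "x \<in> ?Q" "y \<in> ?Q" for x y
      using that nonunits_add[OF V T(2,1)] by auto
    show "r * x \<in> ?Q" if "r \<in> R" "x \<in> ?Q" for r x
      using that nonunits_mult[OF T(1), of x r] overring_R[OF T(1)] by (auto simp: mult.commute)
  qed
  moreover obtain z where z: "z \<notin> T" using T(3) by blast
  obtain a b where ab: "a \<in> R" "b \<in> R" "b \<noteq> 0" "z = a / b" using R_fraction .
  have "1 / b \<notin> T"
  proof
    assume "1 / b \<in> T"
    then have "a * (1 / b) \<in> T" using overring_mult[OF T(1)] overring_R[OF T(1)] ab(1) by blast
    then show False using z ab(4) by simp
  qed
  then have "b \<in> ?Q" using ab by (simp add: nonunits_def)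
  ultimately have "int_ideal R ?Q" using rmod_submod ab(3) unfolding int_ideal_def by blast
  moreover have "?Q \<noteq> R"
  proof -
    have "1 \<notin> ?Q" using overring_one[OF T(1)] by (simp add: nonunits_def)
    then show ?thesis using R_one by blast
  qed
  moreover have "x \<in> ?Q \<or> y \<in> ?Q" if xy: "x \<in> R" "y \<in> R" "x * y \<in> ?Q" for x y
  proof (rule ccontr)
    assume "\<not> ?thesis"
    then have "x \<noteq> 0" "y \<noteq> 0" "1 / x \<in> T" "1 / y \<in> T" using xy by (auto simp: nonunits_def)
    moreover then have "1 / (x * y) \<in> T" using overring_mult[OF T(1), of "1 / x" "1 / y"] by simp
    ultimately show False using xy(3) by (simp add: nonunits_def)
  qed
  ultimately have pr: "prime_ideal R ?Q" unfolding prime_ideal_def by blast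
  show sub: "?Q \<subseteq> M"
  proof (rule subsetI, rule ccontr)
    fix x assume x: "x \<in> ?Q" "x \<notin> M"
    then have "1 / x \<in> T" using loc_inverse[OF M] T(2) by blast
    then show False using x t_Max_zero[OF M] by (auto simp: nonunits_def)
  qed
  show "t_prime R ?Q" using prime_below_t_Max[OF P pr M sub] .
qed

section \<open>Independence of the localizations and its uses\<close>

lemma weakly_Matlis_unique:
  assumes "weakly_Matlis R" "t_prime R Q" "M \<in> t_Max R" "Q \<subseteq> M" "N \<in> t_Max R" "Q \<subseteq> N"
  shows "M = N"
  using assms unfolding weakly_Matlis_def by blast

text \<open>If R_N R_M were not K, its center would be a t-prime contained in both M and N.\<close>

lemma weakly_Matlis_inverse_compositum:
  assumes WM: "weakly_Matlis R" and P: "PvMD R" and M: "M \<in> t_Max R" and N: "N \<in> t_Max R" "N \<noteq> M"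
    and b: "b \<in> R" "b \<noteq> 0"
  shows "1 / b \<in> compositum N M"
proof (rule ccontr)
  let ?T = "compositum N M"
  assume "1 / b \<notin> ?T"
  then have T: "overring ?T" "?T \<noteq> UNIV" using overring_compositum[OF N(1) M] by auto
  have Q: "t_prime R (nonunits ?T \<inter> R)" "nonunits ?T \<inter> R \<subseteq> M"
    using nonunits_t_prime[OF P M T(1) loc_subset_compositum2[OF N(1) M] T(2)] by auto
  have "nonunits ?T \<inter> R \<subseteq> N"
    using nonunits_t_prime(2)[OF P N(1) T(1) loc_subset_compositum1[OF N(1) M] T(2)] .
  then show False using weakly_Matlis_unique[OF WM Q(1) M Q(2) N(1)] N(2) by blast
qed

text \<open>Since s h = (b h) (s/b), an s making s/b integral away from M serves the whole family.
  This turns multipliers found at M into global ones.\<close>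

lemma weakly_Matlis_globalize:
  assumes WM: "weakly_Matlis R" and P: "PvMD R" and M: "M \<in> t_Max R"
    and b: "b \<in> R" "b \<noteq> 0" "\<And>h. h \<in> H \<Longrightarrow> b * h \<in> R"
  obtains s where "s \<in> R" "s \<notin> M" "\<And>N h. N \<in> t_Max R \<Longrightarrow> N \<noteq> M \<Longrightarrow> h \<in> H \<Longrightarrow> s * h \<in> loc R N"
proof -
  have "finite {N \<in> t_Max R. b \<in> N}" using WM b(1,2) unfolding weakly_Matlis_def by blast
  then obtain s where s: "s \<in> R" "s \<notin> M" "\<And>N. N \<in> t_Max R \<Longrightarrow> N \<noteq> M \<Longrightarrow> s / b \<in> loc R N"
    using uniform_denominator[OF M b(1,2)] weakly_Matlis_inverse_compositum[OF WM P M _ _ b(1,2)] by metis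
  have "s * h \<in> loc R N" if N: "N \<in> t_Max R" "N \<noteq> M" and h: "h \<in> H" for N h
  proof -
    have "(b * h) * (s / b) \<in> loc R N" using rmod_mult[OF loc_rmod[OF N(1)] b(3)[OF h] s(3)[OF N]] .
    then show ?thesis using b(2) by (simp add: mult_ac)
  qed
  then show ?thesis using that s by blast
qed

text \<open>If every nonunit of T were a product of two nonunits, the center Q would be
  t-idempotent. At M nonunits are quotients of elements of Q, so the factorizations put Q into Q^2
  R_M; at N \<noteq> M an element of Q outside N does the same.\<close>

lemma strongly_discrete_nonunits:
  assumes WM: "weakly_Matlis R" and SD: "strongly_discrete_PvMD R" and M: "M \<in> t_Max R"
    and T: "overring T" "loc R M \<subseteq> T" "T \<noteq> UNIV"
  obtains q where "q \<in> nonunits T" "\<And>a b. a \<in> nonunits T \<Longrightarrow> b \<in> nonunits T \<Longrightarrow> q \<noteq> a * b"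
proof (rule ccontr)
  assume neg: "\<not> thesis"
  have fac: "\<exists>a\<in>nonunits T. \<exists>b\<in>nonunits T. q = a * b" if "q \<in> nonunits T" for q
    using neg that \<open>\<And>q. \<lbrakk>q \<in> nonunits T; \<And>a b. \<lbrakk>a \<in> nonunits T; b \<in> nonunits T\<rbrakk> \<Longrightarrow> q \<noteq> a * b\<rbrakk> \<Longrightarrow> thesis\<close>
    by blast
  have P: "PvMD R" using SD by (simp add: strongly_discrete_PvMD_def)
  define Q where "Q = nonunits T \<inter> R"
  have Q: "t_prime R Q" "Q \<subseteq> M" unfolding Q_def using nonunits_t_prime[OF P M T] by auto
  have sQ: "submod R Q" using Q(1) by (simp add: t_prime_def prime_ideal_def int_ideal_def)
  have modQ: "rmod Q" using submod_rmod[OF sQ] .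
  have QR: "Q \<subseteq> R" unfolding Q_def by blast
  obtain q where q: "q \<in> Q" "q \<noteq> 0" using submod_nonzero[OF sQ] .
  let ?QQ = "smod_prod Q Q"
  have modQQ: "rmod ?QQ" using rmod_smod_prod[OF modQ] .
  have sQQ: "submod R ?QQ" using rmod_submod[OF modQQ smod_prod_mem[OF q(1) q(1)]] q(2) by simp
  have "?QQ \<subseteq> Q" using QR by (intro smod_prod_least modQ) (blast intro: rmod_mult[OF modQ])
  then have "t_op R ?QQ \<subseteq> Q"
    using t_op_mono[OF sQQ sQ] Q(1) by (simp add: t_prime_def t_ideal_def)
  moreover have "Q \<subseteq> w_op R ?QQ"
  proof
    fix x assume x: "x \<in> Q"
    have "x \<in> lext ?QQ N" if N: "N \<in> t_Max R" for N
    proof (cases "N = M")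
      case True
      obtain a b where ab: "a \<in> nonunits T" "b \<in> nonunits T" "x = a * b"
        using fac x unfolding Q_def by blast
      have "nonunits T \<subseteq> lext Q M"
      proof
        fix c assume c: "c \<in> nonunits T"
        then have "c \<in> loc R M" using nonunits_subset[OF PvMD_loc[OF P M] T(2)] by blast
        then obtain s where s: "s \<in> R" "s \<notin> M" "s * c \<in> R" using loc_iff[OF M] by blast
        have "c * s \<in> nonunits T" using nonunits_mult[OF T(1) c] s(1) overring_R[OF T(1)] by blast
        then show "c \<in> lext Q M" using s unfolding Q_def by (intro lextI[of s]) (auto simp: mult.commute)
      qed
      then obtain s t where st: "s \<in> R" "s \<notin> M" "s * a \<in> Q" "t \<in> R" "t \<notin> M" "t * b \<in> Q"
        using ab unfolding lext_def by blast
      have "(s * a) * (t * b) \<in> ?QQ" using smod_prod_mem st by blast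
      then have "(s * t) * x \<in> ?QQ" using ab(3) by (simp add: mult_ac)
      then show ?thesis using True st t_Max_mult_notin[OF M] by (intro lextI[of "s * t"]) auto
    next
      case False
      then obtain s where s: "s \<in> Q" "s \<notin> N"
        using weakly_Matlis_unique[OF WM Q(1) M Q(2) N] by blast
      then show ?thesis using smod_prod_mem[OF s(1) x] QR by (intro lextI[of s]) auto
    qed
    then show "x \<in> w_op R ?QQ" using w_op_iff[OF modQQ] by blast
  qed
  ultimately have "t_op R ?QQ = Q" using w_op_subset_t_op[OF sQQ] by blast
  then show False using SD Q(1) unfolding strongly_discrete_PvMD_def by blast
qed

text \<open>If \<open>q\<close> is a non-unit of \<open>E(J)\<close>, where \<open>J = I R\<^sub>M\<close>, that is not a product of two non-units,
  then any \<open>x \<in> J\<close> with \<open>x / q \<notin> J\<close> generates \<open>J\<close> over \<open>E(J)\<close>: otherwise some \<open>j \<in> J\<close> would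
  give the factorization \<open>q = (x / j) (q j / x)\<close>.\<close>

lemma local_generator:
  assumes WM: "weakly_Matlis R" and SD: "strongly_discrete_PvMD R" and M: "M \<in> t_Max R"
    and I: "frac_ideal R I"
  obtains x where "x \<in> I" "x \<noteq> 0" "\<And>j. j \<in> lext I M \<Longrightarrow> j / x \<in> Eend (lext I M)"
proof -
  have P: "PvMD R" using SD by (simp add: strongly_discrete_PvMD_def)
  have modI: "rmod I" using I frac_ideal_submod submod_rmod by blast
  obtain d where d: "d \<in> R" "d \<noteq> 0" "\<And>z. z \<in> I \<Longrightarrow> d * z \<in> R" using I unfolding frac_ideal_def by blast
  obtain c where c: "c \<in> I" "c \<noteq> 0" using submod_nonzero[OF frac_ideal_submod[OF I]] .
  define J where "J = lext I M"
  define E where "E = Eend J"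
  have modJ: "rmod J" unfolding J_def using lext_rmod[OF M modI] .
  have Jloc: "j * v \<in> J" if "j \<in> J" "v \<in> loc R M" for j v
    using lext_mult[OF M modI] that unfolding J_def by blast
  have JE: "j * e \<in> J" if "j \<in> J" "e \<in> E" for j e
    using colonD[of e J J j] that by (simp add: E_def Eend_def mult.commute)
  have EI: "e \<in> E" if "\<And>j. j \<in> J \<Longrightarrow> j * e \<in> J" for e
    using that by (auto simp: E_def Eend_def mult.commute intro!: colonI)
  have ovE: "overring E" unfolding E_def using Eend_overring[OF modJ] .
  have VE: "loc R M \<subseteq> E" using EI Jloc by blast
  \<comment> \<open>J is nonzero and d J \<subseteq> R_M, so E = K would force R_M = K. The factor
    \<open>z / (d * c)\<close> is chosen to carry \<open>c\<close> to \<open>z / d\<close>.\<close>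
  have "E \<noteq> UNIV"
  proof
    assume E: "E = UNIV"
    obtain z where z: "z \<notin> loc R M" using loc_not_UNIV[OF M] by blast
    have "c \<in> J" unfolding J_def using lext_subset[OF M] c(1) by blast
    then have "c * (z / (d * c)) \<in> J" using JE E by blast
    then have "z / d \<in> J" using c(2) d(2) by simp
    then obtain s where s: "s \<in> R" "s \<notin> M" "s * (z / d) \<in> I" unfolding J_def lext_def by blast
    then have "s * z \<in> R" using d(3)[OF s(3)] d(2) by simp
    then show False using z loc_iff[OF M] s by blast
  qed
  then obtain q where q: "q \<in> nonunits E" "\<And>a b. a \<in> nonunits E \<Longrightarrow> b \<in> nonunits E \<Longrightarrow> q \<noteq> a * b"
    using strongly_discrete_nonunits[OF WM SD M ovE VE] by blast
  \<comment> \<open>0 = 0 * 0 is a product of two nonunits.\<close>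
  have q0: "q \<noteq> 0" using q by fastforce
  then have "1 / q \<notin> E" using q(1) by (simp add: nonunits_def)
  then obtain x where x: "x \<in> J" "x * (1 / q) \<notin> J" using EI by blast
  have x0: "x \<noteq> 0" using x rmod_zero[OF modJ] by auto
  have gen: "j / x \<in> E" if j: "j \<in> J" for j
  proof (rule ccontr)
    assume nE: "j / x \<notin> E"
    then have j0: "j \<noteq> 0" using overring_zero[OF ovE] by auto
    have "x / j \<in> nonunits E" using nE by (simp add: nonunits_def)
    moreover have "q * j / x \<in> nonunits E"
    proof (rule ccontr)
      assume "q * j / x \<notin> nonunits E"
      then have "x / (q * j) \<in> E" by (simp add: nonunits_def)
      then have "j * (x / (q * j)) \<in> J" using JE[OF j] by blast
      then show False using x(2) j0 by simp
    qed
    ultimately show False using q(2)[of "x / j" "q * j / x"] x0 j0 by simp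
  qed
  \<comment> \<open>A denominator \<open>s\<close> of \<open>x\<close> is a unit of R_M \<subseteq>
    E, so \<open>s * x\<close>, which is in \<open>I\<close>, generates as well.\<close>
  obtain s where s: "s \<in> R" "s \<notin> M" "s * x \<in> I" using x(1) unfolding J_def lext_def by blast
  have "s \<noteq> 0" using s t_Max_zero[OF M] by auto
  moreover have "j / (s * x) \<in> E" if "j \<in> J" for j
  proof -
    have "(1 / s) * (j / x) \<in> E"
      using overring_mult[OF ovE _ gen[OF that]] VE loc_inverse[OF M s(1,2)] by blast
    then show ?thesis by simp
  qed
  ultimately show ?thesis using that[of "s * x"] s(3) x0 unfolding E_def J_def by auto
qed

text \<open>For a generator x of I R_M over its endomorphism ring, s/x lies in (E(I):I) for some s
  outside M. Then s y = x (y s/x) is in the product for every y in E(I).\<close>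

lemma strongly_discrete_w_stable:
  assumes WM: "weakly_Matlis R" and SD: "strongly_discrete_PvMD R"
  shows "w_stable R"
  unfolding w_stable_def
proof (intro allI impI)
  fix I assume wI: "w_ideal R I"
  have P: "PvMD R" using SD by (simp add: strongly_discrete_PvMD_def)
  have frI: "frac_ideal R I" using wI by (simp add: w_ideal_def)
  have modI: "rmod I" using w_ideal_rmod[OF wI] .
  obtain d where d: "d \<in> R" "d \<noteq> 0" "\<And>z. z \<in> I \<Longrightarrow> d * z \<in> R" using frI unfolding frac_ideal_def by blast
  define E where "E = Eend I"
  have ovE: "overring E" unfolding E_def using Eend_overring[OF modI] .
  let ?A = "smod_prod I (colon E I)"
  have modA: "rmod ?A" using rmod_smod_prod[OF modI] .
  have AE: "?A \<subseteq> E"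
  proof (rule smod_prod_least[OF overring_rmod[OF ovE]])
    fix a b assume "a \<in> I" "b \<in> colon E I"
    then show "a * b \<in> E" using colonD[of b E I a] by (simp add: mult.commute)
  qed
  have "w_op R ?A \<subseteq> E"
  proof
    fix z assume z: "z \<in> w_op R ?A"
    have "z * i \<in> I" if i: "i \<in> I" for i
    proof (rule w_idealD[OF wI])
      fix M assume M: "M \<in> t_Max R"
      then obtain s where s: "s \<in> R" "s \<notin> M" "s * z \<in> E"
        using z w_op_iff[OF modA] AE unfolding lext_def by blast
      then have "s * z * i \<in> I" using colonD i unfolding E_def Eend_def by blast
      then show "z * i \<in> lext I M" using s by (intro lextI[of s]) (auto simp: mult.assoc)
    qed
    then show "z \<in> E" unfolding E_def Eend_def by (rule colonI)
  qed
  moreover have "y \<in> w_op R ?A" if y: "y \<in> E" for y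
    unfolding w_op_iff[OF modA]
  proof
    fix M assume M: "M \<in> t_Max R"
    obtain x where x: "x \<in> I" "x \<noteq> 0" "\<And>j. j \<in> lext I M \<Longrightarrow> j / x \<in> Eend (lext I M)"
      using local_generator[OF WM SD M frI] by metis
    obtain a b where ab: "a \<in> R" "b \<in> R" "b \<noteq> 0" "x = a / b" using R_fraction .
    have a0: "a \<noteq> 0" using ab x(2) by auto
    define H where "H = (\<lambda>i. i / x) ` I"
    have "(a * d) * h \<in> R" if h: "h \<in> H" for h
    proof -
      obtain i where i: "i \<in> I" "h = i / x" using h unfolding H_def by blast
      have "(a * d) * h = b * (d * i)" using i ab a0 by (simp add: field_simps)
      then show ?thesis using R_mult[OF ab(2) d(3)[OF i(1)]] by (simp only:)
    qed
    then obtain s where s: "s \<in> R" "s \<notin> M"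
      "\<And>N h. N \<in> t_Max R \<Longrightarrow> N \<noteq> M \<Longrightarrow> h \<in> H \<Longrightarrow> s * h \<in> loc R N"
      using weakly_Matlis_globalize[OF WM P M, of "a * d" H] ab(1) a0 d(1,2) by auto
    \<comment> \<open>At \<open>M\<close> the factor \<open>i / x\<close> is an endomorphism of the
      localization; at every other \<open>N\<close> the choice of \<open>s\<close> puts
      \<open>s * (i / x)\<close> in R_N.\<close>
    have "(s / x) * i * k \<in> I" if ik: "i \<in> I" "k \<in> I" for i k
    proof (rule w_idealD[OF wI])
      fix N assume N: "N \<in> t_Max R"
      show "(s / x) * i * k \<in> lext I N"
      proof (cases "N = M")
        case True
        have "i / x \<in> Eend (lext I M)" using x(3) lext_subset[OF M] ik(1) by blast
        then have "(i / x) * k \<in> lext I M"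
          using colonD lext_subset[OF M] ik(2) unfolding Eend_def by blast
        then have "s * ((i / x) * k) \<in> lext I M" using rmod_mult[OF lext_rmod[OF M modI] s(1)] by blast
        then show ?thesis using True by (simp add: mult_ac)
      next
        case False
        have "s * (i / x) \<in> loc R N" using s(3)[OF N False] ik(1) unfolding H_def by blast
        then have "k * (s * (i / x)) \<in> lext I N"
          using lext_mult[OF N modI] lext_subset[OF N] ik(2) by blast
        then show ?thesis by (simp add: mult_ac)
      qed
    qed
    then have "s / x * i \<in> E" if "i \<in> I" for i
      using that unfolding E_def Eend_def by (intro colonI) blast
    then have "y * (s / x) * i \<in> E" if "i \<in> I" for i
      using overring_mult[OF ovE y] that by (metis mult.assoc)
    then have "y * (s / x) \<in> colon E I" by (rule colonI)
    then have "x * (y * (s / x)) \<in> ?A" using smod_prod_mem[OF x(1)] by blast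
    then have "s * y \<in> ?A" using x(2) by (simp add: mult_ac)
    then show "y \<in> lext ?A M" using s by (intro lextI[of s]) auto
  qed
  ultimately show "w_op R (smod_prod I (colon (Eend I) I)) = Eend I" unfolding E_def by blast
qed

text \<open>For z outside J = I R_M there is g with g J \<subseteq> R_M and g z outside R_M. Some s
  outside M makes s g an element of (R:I), so z in I_v would give s g z in R, hence g z in
  R_M.\<close>

lemma strongly_discrete_w_divisorial:
  assumes WM: "weakly_Matlis R" and SD: "strongly_discrete_PvMD R"
  shows "w_divisorial R"
  unfolding w_divisorial_def divisorial_def
proof (intro allI impI)
  fix I assume wI: "w_ideal R I"
  have P: "PvMD R" using SD by (simp add: strongly_discrete_PvMD_def)
  have frI: "frac_ideal R I" using wI by (simp add: w_ideal_def)
  have modI: "rmod I" using w_ideal_rmod[OF wI] .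
  obtain d where d: "d \<in> R" "d \<noteq> 0" "\<And>z. z \<in> I \<Longrightarrow> d * z \<in> R" using frI unfolding frac_ideal_def by blast
  have "v_op R I \<subseteq> I"
  proof
    fix z assume z: "z \<in> v_op R I"
    show "z \<in> I"
    proof (rule w_idealD[OF wI], rule ccontr)
      fix M assume M: "M \<in> t_Max R" and nz: "z \<notin> lext I M"
      note V = PvMD_loc[OF P M]
      define J where "J = lext I M"
      have modJ: "rmod J" unfolding J_def using lext_rmod[OF M modI] .
      have z0: "z \<noteq> 0" using nz rmod_zero[OF modJ] unfolding J_def by auto
      have Jloc: "j * v \<in> J" if "j \<in> J" "v \<in> loc R M" for j v
        using lext_mult[OF M modI] that unfolding J_def by blast
      have "\<exists>g. (\<forall>j\<in>J. g * j \<in> loc R M) \<and> g * z \<notin> loc R M"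
      \<comment> \<open>If E(J) = R_M, then J = x R_M and g = 1/x works. Otherwise take e in E(J)
        outside R_M and g = e/z: if e j/z were outside R_M, then z would be in e j R_M \<subseteq>
        J.\<close>
      proof (cases "Eend J \<subseteq> loc R M")
        case True
        obtain x where x: "x \<in> I" "x \<noteq> 0" "\<And>j. j \<in> J \<Longrightarrow> j / x \<in> Eend J"
          using local_generator[OF WM SD M frI] unfolding J_def by metis
        have "x \<in> J" unfolding J_def using lext_subset[OF M] x(1) by blast
        then have "(1 / x) * z \<notin> loc R M" using Jloc[of x "(1 / x) * z"] nz x(2) unfolding J_def by auto
        then show ?thesis using x(3) True by (intro exI[of _ "1 / x"]) auto
      next
        case False
        then obtain e where e: "e \<in> Eend J" "e \<notin> loc R M" by blast
        have "(e / z) * j \<in> loc R M" if j: "j \<in> J" for j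
        proof (rule ccontr)
          assume n: "(e / z) * j \<notin> loc R M"
          then have ej: "e * j \<noteq> 0" using overring_zero[OF overring_loc[OF M]] by auto
          have "z / (e * j) \<in> loc R M"
            using valuation_overring_cases[OF V ej z0] n by auto
          moreover have "e * j \<in> J" using colonD e(1) j unfolding Eend_def by blast
          ultimately have "(e * j) * (z / (e * j)) \<in> J" using Jloc by blast
          then show False using nz ej unfolding J_def by simp
        qed
        then show ?thesis using e(2) z0 by (intro exI[of _ "e / z"]) auto
      qed
      then obtain g where g: "\<And>j. j \<in> J \<Longrightarrow> g * j \<in> loc R M" "g * z \<notin> loc R M" by blast
      obtain a b where ab: "a \<in> R" "b \<in> R" "b \<noteq> 0" "g = a / b" using R_fraction .
      define H where "H = (\<lambda>i. g * i) ` I"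
      have "(b * d) * h \<in> R" if h: "h \<in> H" for h
      proof -
        obtain i where i: "i \<in> I" "h = g * i" using h unfolding H_def by blast
        have "(b * d) * h = a * (d * i)" using i ab by (simp add: field_simps)
        then show ?thesis using R_mult[OF ab(1) d(3)[OF i(1)]] by (simp only:)
      qed
      then obtain s where s: "s \<in> R" "s \<notin> M"
        "\<And>N h. N \<in> t_Max R \<Longrightarrow> N \<noteq> M \<Longrightarrow> h \<in> H \<Longrightarrow> s * h \<in> loc R N"
        using weakly_Matlis_globalize[OF WM P M, of "b * d" H] ab(2,3) d(1,2) by auto
      have "(s * g) * i \<in> R" if i: "i \<in> I" for i
      proof (rule in_R_if_loc)
        fix N assume N: "N \<in> t_Max R"
        show "(s * g) * i \<in> loc R N"
        proof (cases "N = M")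
          case True
          have "g * i \<in> loc R M" using g(1) lext_subset[OF M] i unfolding J_def by blast
          then show ?thesis using True rmod_mult[OF loc_rmod[OF M] s(1)] by (simp add: mult.assoc)
        next
          case False
          have "g * i \<in> H" using i unfolding H_def by blast
          then show ?thesis using s(3)[OF N False] by (simp add: mult.assoc)
        qed
      qed
      then have "z * (s * g) \<in> R" by (rule v_op_memD[OF z])
      then have "s * (g * z) \<in> R" by (simp add: mult_ac)
      then show False using g(2) loc_iff[OF M] s by blast
    qed
  qed
  then show "v_op R I = I" using v_op_increasing by blast
qed

text \<open>In R_M each radical ideal becomes a prime or the whole ring, and these form a chain with
  union U. A proper U is the maximal ideal of an overring, so some q in U is no product of two
  elements of U. The \<open>Q n\<close> containing q is largest: an x in \<open>Q m\<close> outside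
  it would give q = x (q/x) with q/x in \<open>Q n\<close>.\<close>

lemma radical_localizations_have_maximum:
  fixes f :: "nat \<Rightarrow> 'a set"
  assumes WM: "weakly_Matlis R" and SD: "strongly_discrete_PvMD R" and M: "M \<in> t_Max R"
    and f: "\<And>n. radical_ideal R (f n)"
  shows "\<exists>n. \<forall>m. lext (f m) M \<subseteq> lext (f n) M"
proof -
  have P: "PvMD R" using SD by (simp add: strongly_discrete_PvMD_def)
  note V = PvMD_loc[OF P M]
  have ovV: "overring (loc R M)" using overring_loc[OF M] .
  have fmod: "rmod (f n)" and fR: "f n \<subseteq> R" for n
    using f[of n] submod_rmod by (auto simp: radical_ideal_def int_ideal_def)
  define Q where "Q n = lext (f n) M" for n
  have QV: "Q n \<subseteq> loc R M" for n unfolding Q_def using lext_mono[OF fR] lext_R[OF M] by blast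
  have Qmod: "rmod (Q n)" for n unfolding Q_def using lext_rmod[OF M fmod] .
  have Qmult: "x * v \<in> Q n" if "x \<in> Q n" "v \<in> loc R M" for n x v
    unfolding Q_def using lext_mult[OF M fmod] that unfolding Q_def by blast
  have Qrad: "z \<in> Q n" if z: "z \<in> loc R M" "z * z \<in> Q n" for n z
  proof -
    obtain t where t: "t \<in> R" "t \<notin> M" "t * z \<in> R" using z(1) loc_iff[OF M] by blast
    obtain s where s: "s \<in> R" "s \<notin> M" "s * (z * z) \<in> f n" using z(2) unfolding Q_def lext_def by blast
    have "(s * t * z) ^ 2 = (s * t * t) * (s * (z * z))" by (simp add: power2_eq_square mult_ac)
    also have "\<dots> \<in> f n" using rmod_mult[OF fmod _ s(3)] s(1) t(1) by blast
    finally have "(s * t * z) ^ 2 \<in> f n" .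
    moreover have "s * t * z \<in> R" using s t by (simp add: mult.assoc R_mult)
    ultimately have "s * t * z \<in> f n" using f[of n] unfolding radical_ideal_def by (metis zero_less_numeral)
    then show ?thesis unfolding Q_def using s t t_Max_mult_notin[OF M] by (intro lextI[of "s * t"]) auto
  qed
  define U where "U = (\<Union>n. Q n)"
  show ?thesis
  proof (cases "1 \<in> U")
    case True
    then obtain n where n: "1 \<in> Q n" unfolding U_def by blast
    then have "Q m \<subseteq> Q n" for m using QV[of m] Qmult[OF n] by auto
    then show ?thesis unfolding Q_def by blast
  next
    case False
    have Umult: "x * v \<in> U" if "x \<in> U" "v \<in> loc R M" for x v
      using that Qmult unfolding U_def by blast
    have Urad: "z \<in> U" if "z \<in> loc R M" "z * z \<in> U" for z
      using that Qrad unfolding U_def by blast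
    have U0: "0 \<in> U" unfolding U_def using rmod_zero[OF Qmod] by blast
    \<comment> \<open>The localization of R_M at U: an element outside R_M has its inverse in R_M,
      so only whether the inverse avoids U matters. In this form the nonunits of T are visibly
      U.\<close>
    define T where "T = {z. z = 0 \<or> 1 / z \<notin> U}"
    have VT: "loc R M \<subseteq> T"
    proof
      fix z assume z: "z \<in> loc R M"
      then show "z \<in> T" using Umult[of "1 / z" z] False unfolding T_def by (cases "z = 0") auto
    qed
    have Tmult: "x * y \<in> T" if xy: "x \<in> T" "y \<in> T" for x y
    proof (rule ccontr)
      assume "x * y \<notin> T"
      then have nz: "x \<noteq> 0" "y \<noteq> 0" and U: "1 / (x * y) \<in> U" unfolding T_def by auto
      have nU: "1 / x \<notin> U" "1 / y \<notin> U" using xy nz unfolding T_def by auto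
      have "x \<notin> loc R M" using Umult[OF U, of x] nU(2) nz by auto
      then have x: "1 / x \<in> loc R M" using valuation_overring_cases[OF V nz(1), of 1] by auto
      have "y \<notin> loc R M" using Umult[OF U, of y] nU(1) nz by auto
      then have y: "1 / y \<in> loc R M" using valuation_overring_cases[OF V nz(2), of 1] by auto
      \<comment> \<open>Of 1/x and 1/y, the one divisible by the other has its square in U, and U is
        closed under square roots in R_M.\<close>
      show False
      proof (rule valuation_overring_cases[OF V nz])
        assume "x / y \<in> loc R M"
        then have "(1 / y) * (1 / y) \<in> U" using Umult[OF U, of "x / y"] nz by simp
        then show False using Urad[OF y] nU by blast
      next
        assume "y / x \<in> loc R M"
        then have "(1 / x) * (1 / x) \<in> U" using Umult[OF U, of "y / x"] nz by simp
        then show False using Urad[OF x] nU by blast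
      qed
    qed
    have Tadd: "x + y \<in> T" if xy: "x \<in> T" "y \<in> T" for x y
    proof (cases "x = 0 \<or> y = 0")
      case True then show ?thesis using xy by auto
    next
      case False
      then have nz: "x \<noteq> 0" "y \<noteq> 0" by auto
      have one: "1 + v \<in> T" if "v \<in> loc R M" for v
        using overring_add[OF ovV overring_one[OF ovV] that] VT by blast
      show ?thesis
      proof (rule valuation_overring_cases[OF V nz])
        assume "x / y \<in> loc R M"
        then have "y * (1 + x / y) \<in> T" using Tmult[OF xy(2) one] by blast
        moreover have "y * (1 + x / y) = x + y" using nz by (simp add: field_simps)
        ultimately show ?thesis by simp
      next
        assume "y / x \<in> loc R M"
        then have "x * (1 + y / x) \<in> T" using Tmult[OF xy(1) one] by blast
        moreover have "x * (1 + y / x) = x + y" using nz by (simp add: field_simps)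
        ultimately show ?thesis by simp
      qed
    qed
    have ovT: "overring T"
      unfolding overring_def using Tadd Tmult VT R_subset_loc[OF M] by blast
    have nuT: "nonunits T = U" unfolding nonunits_def T_def using U0 by auto
    obtain c where c: "c \<in> f 0" "c \<noteq> 0"
      using f[of 0] submod_nonzero unfolding radical_ideal_def int_ideal_def by blast
    then have "c \<in> U" using lext_subset[OF M] unfolding U_def Q_def by blast
    then have "1 / c \<notin> T" using c(2) unfolding T_def by simp
    then have "T \<noteq> UNIV" by blast
    then obtain q where q: "q \<in> U" "\<And>a b. a \<in> U \<Longrightarrow> b \<in> U \<Longrightarrow> q \<noteq> a * b"
      using strongly_discrete_nonunits[OF WM SD M ovT VT] unfolding nuT by blast
    have q0: "q \<noteq> 0" using q U0 by fastforce
    obtain n where n: "q \<in> Q n" using q(1) unfolding U_def by blast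
    have "Q m \<subseteq> Q n" for m
    proof (rule subsetI, rule ccontr)
      fix x assume x: "x \<in> Q m" "x \<notin> Q n"
      have x0: "x \<noteq> 0" using x(2) rmod_zero[OF Qmod] by auto
      have xV: "x \<in> loc R M" using x(1) QV by blast
      have div: "q / y \<in> loc R M" if y: "y \<notin> Q n" "y \<noteq> 0" for y
      proof (rule ccontr)
        assume "q / y \<notin> loc R M"
        then have "y / q \<in> loc R M" using valuation_overring_cases[OF V q0 y(2)] by blast
        then show False using Qmult[OF n, of "y / q"] q0 y(1) by simp
      qed
      \<comment> \<open>Neither x nor x^2 is in \<open>Q n\<close>, so both divide q; hence (q/x)^2
        = q (q/x^2) is in \<open>Q n\<close>, and so is q/x.\<close>
      have "x * x \<notin> Q n" using Qrad[OF xV] x(2) by blast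
      then have "q * (q / (x * x)) \<in> Q n" using div[of "x * x"] x0 Qmult[OF n] by (metis mult_eq_0_iff)
      then have "(q / x) * (q / x) \<in> Q n" by simp
      then have "q / x \<in> Q n" using Qrad div[OF x(2) x0] by blast
      then have "x \<in> U" "q / x \<in> U" using x(1) unfolding U_def by blast+
      then show False using q(2)[of x "q / x"] x0 by simp
    qed
    then show ?thesis unfolding Q_def by blast
  qed
qed

text \<open>A nonzero c in \<open>f 0\<close> is outside almost all t-maximal ideals, and there
  every \<open>f n\<close> extends to all of R_M. At the finitely many others the extensions reach a
  maximum, and a t-ideal is determined by its extensions.\<close>

lemma strongly_discrete_acc_radical_t:
  assumes WM: "weakly_Matlis R" and SD: "strongly_discrete_PvMD R"
  shows "acc_radical_t R"
  unfolding acc_radical_t_def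
proof (intro allI impI)
  fix f :: "nat \<Rightarrow> 'a set"
  assume f: "\<forall>n. radical_ideal R (f n) \<and> t_ideal R (f n) \<and> f n \<subseteq> f (Suc n)"
  have rad: "radical_ideal R (f n)" and ti: "t_ideal R (f n)" and Suc: "f n \<subseteq> f (Suc n)" for n
    using f by auto
  have fR: "f n \<subseteq> R" for n using rad[of n] by (simp add: radical_ideal_def int_ideal_def)
  have mono: "f m \<subseteq> f n" if "m \<le> n" for m n using lift_Suc_mono_le[of f, OF Suc that] .
  obtain c where c: "c \<in> f 0" "c \<noteq> 0"
    using rad[of 0] submod_nonzero unfolding radical_ideal_def int_ideal_def by blast
  define A where "A = {M \<in> t_Max R. c \<in> M}"
  have "c \<in> R" using c(1) fR by blast
  then have A: "finite A" using WM c(2) unfolding weakly_Matlis_def A_def by blast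
  have "\<exists>n. \<forall>m. lext (f m) M \<subseteq> lext (f n) M" if "M \<in> t_Max R" for M
    using radical_localizations_have_maximum[OF WM SD that, of f] rad by blast
  then obtain k where k: "\<And>M m. M \<in> t_Max R \<Longrightarrow> lext (f m) M \<subseteq> lext (f (k M)) M" by metis
  \<comment> \<open>The sum bounds every \<open>k M\<close> over the finite \<open>A\<close>, and is
    defined also for empty \<open>A\<close>.\<close>
  define n where "n = (\<Sum>M\<in>A. k M)"
  have "f m \<subseteq> f n" for m
  proof
    fix x assume x: "x \<in> f m"
    show "x \<in> f n"
    proof (rule w_idealD[OF t_ideal_w_ideal[OF ti]])
      fix M assume M: "M \<in> t_Max R"
      show "x \<in> lext (f n) M"
      proof (cases "c \<in> M")
        case True
        then have "M \<in> A" using M by (simp add: A_def)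
        then have "k M \<le> n" unfolding n_def using A by (simp add: member_le_sum)
        then have "lext (f (k M)) M \<subseteq> lext (f n) M" using lext_mono[OF mono] by blast
        then show ?thesis using k[OF M, of m] x lext_subset[OF M] by blast
      next
        case False
        have cn: "c \<in> f n" using c(1) mono[of 0 n] by auto
        have "rmod (f n)" using rad[of n] submod_rmod by (simp add: radical_ideal_def int_ideal_def)
        then have "x * c \<in> f n" using rmod_mult[of "f n" x c] x fR cn by blast
        then show ?thesis
          using False \<open>c \<in> R\<close> by (intro lextI[of c]) (auto simp: mult.commute)
      qed
    qed
  qed
  then show "\<exists>N. \<forall>n\<ge>N. f n = f N" using mono by (metis subset_antisym)
qed

end

theorem theorem2p7:
  fixes R :: "'a::field set"
  assumes "is_domain_with_qf R" and "R \<noteq> UNIV"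
  shows "(integrally_closed R \<and> w_divisorial R \<and> w_stable R
            \<longleftrightarrow> w_stable R \<and> w_divisorial R \<and> PvMD R)
       \<and> (w_stable R \<and> w_divisorial R \<and> PvMD R
            \<longleftrightarrow> w_divisorial R \<and> generalized_Krull R)
       \<and> (w_divisorial R \<and> generalized_Krull R
            \<longleftrightarrow> weakly_Matlis R \<and> w_stable R \<and> PvMD R)
       \<and> (weakly_Matlis R \<and> w_stable R \<and> PvMD R
            \<longleftrightarrow> weakly_Matlis R \<and> strongly_discrete_PvMD R)
       \<and> (weakly_Matlis R \<and> strongly_discrete_PvMD R
            \<longleftrightarrow> weakly_Matlis R \<and> generalized_Krull R)"
proof -
  interpret domain_qf R by unfold_locales (rule assms(1))
  have "strongly_discrete_PvMD R \<Longrightarrow> PvMD R" by (simp add: strongly_discrete_PvMD_def)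
  \<comment> \<open>Each of the six conditions is equivalent to \<open>weakly_Matlis R\<close>
    together with \<open>strongly_discrete_PvMD R\<close>; given the lemmas this is
    propositional.\<close>
  then show ?thesis
    unfolding generalized_Krull_def
    using PvMD_integrally_closed integrally_closed_w_stable_PvMD w_stable_PvMD_strongly_discrete
      w_divisorial_PvMD_weakly_Matlis strongly_discrete_w_stable strongly_discrete_w_divisorial
      strongly_discrete_acc_radical_t
    by argo
qed

end
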